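(* Let $p>q$ be odd primes and let $G\leq\operatorname{Sym}(\Omega)$ be a transitive group of degree $|\Omega|=pq$ admitting a unique (non-trivial) block system $\mathcal{B}$, whose blocks are of size $q$. Let $\overline{G}\leq\operatorname{Sym}(\mathcal{B})$ be the group induced by the action of $G$ on $\mathcal{B}$, and suppose that the kernel $\operatorname{Ker}(G\to\overline{G})$ is non-trivial. Assume moreover that $G$ is minimally transitive with intersection density $\rho(G)=q$. Then there is a $[p,k]_q$ cyclic code $C$ (for some $k$) such that the Hamming weight $w(\mathbf{c})$ is at most $p-1$ for all $\mathbf{c}\in C$.
   Context: All groups are finite. A block of a transitive group $G\leq\operatorname{Sym}(\Omega)$ is a subset $S\subseteq\Omega$ such that for every $g\in G$ either $S^g=S$ or $S^g\cap S=\varnothing$. A block system is a $G$-invariant partition $\{S^g : g\in G\}$ of $\Omega$ for a block $S$; it is non-trivial if $1<|S|<|\Omega|$. A transitive group is minimally transitive if none of its proper subgroups is transitive. A subset $\mathcal{F}\subseteq G$ is intersecting if for all $g,h\in\mathcal{F}$ there exists $\omega\in\Omega$ with $\omega^g=\omega^h$. The intersection density of $G$ is $\rho(G)=\max\{|\mathcal{F}|/|G_\omega| : \mathcal{F}\subseteq G \text{ intersecting}\}$, where $G_\omega$ is the stabilizer of a point $\omega\in\Omega$. An $[n,k]_q$ linear code is a $k$-dimensional $\mathbb{F}_q$-subspace $C$ of $\mathbb{F}_q^n$; it is cyclic if $(c_0,\dots,c_{n-1})\in C$ implies $(c_{n-1},c_0,\dots,c_{n-2})\in C$. The Hamming weight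 $w(\mathbf{c})$ of $\mathbf{c}\in\mathbb{F}_q^n$ is its number of non-zero entries. *)

theory Defs
  imports
    "HOL-Algebra.Group_Action"
    "HOL-Library.Cardinality"
    "HOL-Library.Disjoint_Sets"
    "HOL-Computational_Algebra.Primes"
    "Jordan_Normal_Form.VS_Connect"
begin

section \<open>Permutation groups\<close>

text \<open>
  A permutation group on \<open>\<Omega>\<close> is given by the set \<open>G\<close> of its elements, a subgroup of
  \<^term>\<open>BijGroup \<Omega>\<close>. Permutations act on the left; all notions below are insensitive to the
  choice between left and right actions.
\<close>

definition perm_group :: "'a set \<Rightarrow> ('a \<Rightarrow> 'a) set \<Rightarrow> ('a \<Rightarrow> 'a) monoid" where
  "perm_group \<Omega> G = (BijGroup \<Omega>)\<lparr>carrier := G\<rparr>"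

definition transitive_on :: "'a set \<Rightarrow> ('a \<Rightarrow> 'a) set \<Rightarrow> bool" where
  "transitive_on \<Omega> G \<longleftrightarrow> transitive_action (perm_group \<Omega> G) \<Omega> (\<lambda>g. g)"

definition minimally_transitive :: "'a set \<Rightarrow> ('a \<Rightarrow> 'a) set \<Rightarrow> bool" where
  "minimally_transitive \<Omega> G \<longleftrightarrow>
     transitive_on \<Omega> G \<and>
     (\<forall>H. subgroup H (BijGroup \<Omega>) \<and> H \<subset> G \<longrightarrow> \<not> transitive_on \<Omega> H)"

definition is_block :: "'a set \<Rightarrow> ('a \<Rightarrow> 'a) set \<Rightarrow> 'a set \<Rightarrow> bool" where
  "is_block \<Omega> G S \<longleftrightarrow> S \<subseteq> \<Omega> \<and> (\<forall>g\<in>G. g ` S = S \<or> g ` S \<inter> S = {})"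

text \<open>
  \<open>G\<close>-invariance of \<open>\<B>\<close> is automatic, as \<open>\<B>\<close> is the set of translates of a block under a group.
\<close>

definition nontrivial_block_system ::
    "'a set \<Rightarrow> ('a \<Rightarrow> 'a) set \<Rightarrow> 'a set set \<Rightarrow> bool" where
  "nontrivial_block_system \<Omega> G \<B> \<longleftrightarrow>
     partition_on \<Omega> \<B> \<and>
     (\<exists>S. is_block \<Omega> G S \<and> 1 < card S \<and> card S < card \<Omega> \<and> \<B> = (\<lambda>g. g ` S) ` G)"

definition block_action :: "'a set set \<Rightarrow> ('a \<Rightarrow> 'a) \<Rightarrow> 'a set \<Rightarrow> 'a set" where
  "block_action \<B> g = (\<lambda>S\<in>\<B>. g ` S)"

definition induced_group :: "'a set set \<Rightarrow> ('a \<Rightarrow> 'a) set \<Rightarrow> ('a set \<Rightarrow> 'a set) set" where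
  "induced_group \<B> G = block_action \<B> ` G"

definition block_kernel ::
    "'a set \<Rightarrow> ('a \<Rightarrow> 'a) set \<Rightarrow> 'a set set \<Rightarrow> ('a \<Rightarrow> 'a) set" where
  "block_kernel \<Omega> G \<B> =
     kernel (perm_group \<Omega> G) (perm_group \<B> (induced_group \<B> G)) (block_action \<B>)"

definition intersecting :: "'a set \<Rightarrow> ('a \<Rightarrow> 'a) set \<Rightarrow> bool" where
  "intersecting \<Omega> F \<longleftrightarrow> (\<forall>g\<in>F. \<forall>h\<in>F. \<exists>\<omega>\<in>\<Omega>. g \<omega> = h \<omega>)"

text \<open>
  Meaningful for transitive \<open>G\<close> on a finite non-empty \<open>\<Omega>\<close>: all point stabilizers then have the
  same order, so letting \<open>\<omega>\<close> range over \<open>\<Omega>\<close> agrees with fixing any one point.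
\<close>

definition intersection_density :: "'a set \<Rightarrow> ('a \<Rightarrow> 'a) set \<Rightarrow> real" where
  "intersection_density \<Omega> G =
     Max {real (card F) / real (card (stabilizer (perm_group \<Omega> G) (\<lambda>g. g) \<omega>)) | F \<omega>.
            \<omega> \<in> \<Omega> \<and> F \<subseteq> G \<and> intersecting \<Omega> F}"


section \<open>Linear codes\<close>

text \<open>The field \<open>\<F>\<^sub>q\<close> is any type \<open>'f\<close> of class \<open>field\<close> with \<open>CARD('f) = q\<close>.\<close>

definition linear_code :: "nat \<Rightarrow> nat \<Rightarrow> 'f::field vec set \<Rightarrow> bool" where
  "linear_code n k C \<longleftrightarrow>
     VectorSpace.subspace class_ring C (module_vec TYPE('f) n) \<and>
     vectorspace.dim class_ring ((module_vec TYPE('f) n)\<lparr>carrier := C\<rparr>) = k"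

text \<open>The entry of the shifted word at position \<open>i\<close> is \<open>c\<^bsub>i-1\<^esub>\<close>, indices modulo \<open>n\<close>.\<close>

definition cyclic_shift :: "'f vec \<Rightarrow> 'f vec" where
  "cyclic_shift c =
     vec (dim_vec c) (\<lambda>i. c $ ((i + dim_vec c - 1) mod dim_vec c))"

definition cyclic_code :: "nat \<Rightarrow> nat \<Rightarrow> 'f::field vec set \<Rightarrow> bool" where
  "cyclic_code n k C \<longleftrightarrow> linear_code n k C \<and> (\<forall>c\<in>C. cyclic_shift c \<in> C)"

definition hamming_weight :: "'f::zero vec \<Rightarrow> nat" where
  "hamming_weight c = card {i. i < dim_vec c \<and> c $ i \<noteq> 0}"

end

theory Submission
  imports Defs
    "HOL-Algebra.Sylow"
    "HOL-Number_Theory.Residues"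
begin

text \<open>
  Let \<open>K\<close> be the kernel of the action on the \<open>p\<close> blocks. It is normal and nontrivial, so it is
  transitive on every block, and \<open>q\<close> divides its order. An element of order \<open>p\<close> lies outside \<open>K\<close>,
  since a block has fewer than \<open>p\<close> points; hence it rotates the blocks in a single cycle of
  length \<open>p\<close>. Together with \<open>K\<close> it generates a transitive group, which is \<open>G\<close> by minimality.
  Consequently \<open>|G| = p |K|\<close>, and an element of \<open>G\<close> that fixes a point lies in \<open>K\<close>.

  An intersecting set is therefore contained in a coset of \<open>K\<close>. Intersection density \<open>q\<close> yields an
  intersecting set of size \<open>q |G\<^sub>\<omega>| = |G| / p = |K|\<close>, which must be a full coset of \<open>K\<close>. So \<open>K\<close> itself is
  intersecting, that is, no element of \<open>K\<close> is a derangement (lemma \<open>kernel_no_derangement\<close>).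

  For the code, let \<open>P\<close> be a Sylow \<open>q\<close>-subgroup of \<open>K\<close>. By the Frattini argument some rotation \<open>g\<close> of
  order \<open>p\<close> normalizes \<open>P\<close> (lemma \<open>exists_sylow_normalized_by_rotation\<close>). An element of \<open>q\<close>-power
  order with a fixed point in an invariant set of \<open>q\<close> points is trivial on that set, so \<open>P\<close> acts on
  each block either trivially or as a regular cyclic group of order \<open>q\<close>. Fixing a block \<open>B\<^sub>0\<close> on which
  \<open>P\<close> is nontrivial and \<open>s \<in> P\<close> that moves a point of \<open>B\<^sub>0\<close>, every \<open>x \<in> P\<close> acts on \<open>B\<^sub>0\<close> as a power of \<open>s\<close>,
  with an exponent \<open>\<phi>(x)\<close> in \<open>\<int>/q\<close>. The words with entries \<open>\<phi>(g\<^sup>-\<^sup>i x g\<^sup>i)\<close>, for \<open>i < p\<close>, form a linear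
  code, because \<open>\<phi>\<close> is a homomorphism and the field is a prime field; it is cyclic, because \<open>g\<close>
  normalizes \<open>P\<close>; and it is nonzero, because \<open>\<phi>(s) \<noteq> 0\<close>. A fixed point of \<open>x\<close> in the block \<open>g\<^sup>i(B\<^sub>0)\<close> makes
  the entry at \<open>i\<close> vanish, and every \<open>x \<in> P \<subseteq> K\<close> has a fixed point. Hence no codeword has weight \<open>p\<close>.
\<close>

section \<open>Iterates of periodic maps\<close>

lemma funpow_fixed_mult:
  assumes "(f ^^ n) x = x"
  shows "(f ^^ (n * k)) x = x"
  using assms by (induction k) (simp_all add: funpow_add)

lemma fixed_of_coprime_funpow:
  fixes n i :: nat
  assumes "(f ^^ n) x = x" and "(f ^^ i) x = x" and "coprime i n"
  shows "f x = x"
proof (cases "i = 0")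
  case True
  then show ?thesis using assms by simp
next
  case False
  then obtain u v where "i * u = n * v + 1"
    using bezout_nat[of i n] assms(3) by auto
  then have "x = f ((f ^^ (n * v)) x)"
    using funpow_fixed_mult[OF assms(2), of u] by simp
  then show ?thesis using funpow_fixed_mult[OF assms(1), of v] by simp
qed

text \<open>Injectivity of \<open>f\<close> is not needed for a coincidence of two iterates to give a fixed point,
  because \<open>x\<close> is recovered from its iterates by periodicity.\<close>

lemma fixed_of_funpow_eq:
  fixes n i j :: nat
  assumes "(f ^^ n) x = x" and "0 < n" and "i < j" and "coprime (j - i) n"
    and "(f ^^ i) x = (f ^^ j) x"
  shows "f x = x"
proof -
  define y where "y = (f ^^ i) x"
  have "(f ^^ (j - i)) y = (f ^^ (j - i + i)) x"
    unfolding y_def by (simp only: funpow_add o_apply)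
  then have "(f ^^ (j - i)) y = y" using assms(3,5) by (simp add: y_def)
  moreover have "(f ^^ n) y = (f ^^ (i + n)) x"
    unfolding y_def by (simp only: add.commute[of i n] funpow_add o_apply)
  then have "(f ^^ n) y = y" by (simp add: y_def assms(1) funpow_add)
  ultimately have fy: "f y = y" using fixed_of_coprime_funpow assms(4) by metis
  \<comment> \<open>A further \<open>k\<close> steps complete \<open>i\<close> full periods, so they lead from \<open>y\<close> back to \<open>x\<close>.\<close>
  define k where "k = n * i - i"
  have "k + i = n * i" using assms(2) by (simp add: k_def)
  then have xy: "x = (f ^^ k) y"
    unfolding y_def using funpow_fixed_mult[OF assms(1), of i]
    by (simp flip: o_apply[of "f ^^ k" "f ^^ i"] funpow_add)
  have "(f ^^ k) y = y" using fy by (induction k) auto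
  then show ?thesis using fy xy by simp
qed

lemma inj_on_funpow_orbit:
  fixes m n :: nat
  assumes "(f ^^ n) x = x" and "0 < n" and "\<And>i. 0 < i \<Longrightarrow> i < m \<Longrightarrow> coprime i n"
    and "f x \<noteq> x"
  shows "inj_on (\<lambda>i. (f ^^ i) x) {..<m}"
proof (rule linorder_inj_onI')
  fix i j assume "i \<in> {..<m}" "j \<in> {..<m}" "i < j"
  then show "(f ^^ i) x \<noteq> (f ^^ j) x"
    using fixed_of_funpow_eq[OF assms(1,2), of i j] assms(3,4) by auto
qed

lemma funpow_in:
  assumes "f ` B \<subseteq> B" and "x \<in> B"
  shows "(f ^^ i) x \<in> B"
  using assms by (induction i) auto

text \<open>If \<open>n\<close> is coprime to all positive numbers below \<open>m\<close>, then the nontrivial cycles of a map of period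
  \<open>n\<close> have length at least \<open>m\<close>. So such a map fixes every point of an invariant set of fewer than \<open>m\<close>
  points, and permutes an invariant set of \<open>m\<close> points in a single cycle once it moves one of them.
  This is used with \<open>n\<close> a power of \<open>p\<close> or \<open>q\<close>.\<close>

lemma periodic_map_trivial:
  fixes m n :: nat
  assumes "f ` B \<subseteq> B" and "finite B" and "card B < m" and "x \<in> B"
    and "(f ^^ n) x = x" and "0 < n" and "\<And>i. 0 < i \<Longrightarrow> i < m \<Longrightarrow> coprime i n"
  shows "f x = x"
proof (rule ccontr)
  assume "f x \<noteq> x"
  then have "inj_on (\<lambda>i. (f ^^ i) x) {..<m}"
    using inj_on_funpow_orbit assms by metis
  then have "card {..<m} \<le> card B"
    using card_inj_on_le funpow_in[OF assms(1,4)] assms(2) by (metis image_subsetI)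
  then show False using assms(3) by simp
qed

lemma periodic_map_cyclic:
  fixes m n :: nat
  assumes "f ` B \<subseteq> B" and "finite B" and "card B = m" and "x \<in> B"
    and "(f ^^ n) x = x" and "0 < n" and "\<And>i. 0 < i \<Longrightarrow> i < m \<Longrightarrow> coprime i n"
    and "f x \<noteq> x"
  shows "B = (\<lambda>i. (f ^^ i) x) ` {..<m}"
proof -
  have "card ((\<lambda>i. (f ^^ i) x) ` {..<m}) = m"
    using inj_on_funpow_orbit[OF assms(5,6,7,8)] by (simp add: card_image)
  moreover have "(\<lambda>i. (f ^^ i) x) ` {..<m} \<subseteq> B"
    using funpow_in[OF assms(1,4)] by blast
  ultimately show ?thesis using assms(2,3) card_subset_eq by metis
qed

lemma funpow_image:
  fixes f :: "'b \<Rightarrow> 'b"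
  shows "((\<lambda>A. f ` A) ^^ i) B = (f ^^ i) ` B"
  by (induction i) (auto simp: image_comp)


section \<open>Fixed points of groups of prime power order and conjugacy of Sylow subgroups\<close>

lemma (in group_action) prime_dvd_card_of_no_fixed_point:
  assumes "prime r" and "Coset.order G = r ^ a" and "finite E"
    and "\<And>x. x \<in> E \<Longrightarrow> \<exists>g\<in>carrier G. \<phi> g x \<noteq> x"
  shows "r dvd card E"
proof -
  have "r dvd card B" if orb: "B \<in> orbits G E \<phi>" for B
  proof -
    obtain x where x: "x \<in> E" "B = orbit G \<phi> x"
      using orb unfolding orbits_def by blast
    obtain g where g: "g \<in> carrier G" "\<phi> g x \<noteq> x" using assms(4) x by blast
    have "B \<noteq> {x}"
      using g x unfolding orbit_def by blast
    moreover have "x \<in> B" using orbit_refl x by blast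
    ultimately have "card B \<noteq> 1" by (metis card_1_singletonE singletonD)
    moreover have "card B dvd r ^ a"
      using orbit_stabilizer_theorem[OF x(1)] x(2) assms(2) by (metis dvd_triv_left)
    ultimately show ?thesis
      using assms(1) by (metis divides_primepow_nat dvd_power gr0I power_0)
  qed
  then have "r dvd card (\<Union> (orbits G E \<phi>))"
    using disjoint_union orbits_coverture assms(3) by (intro dvd_partition) auto
  then show ?thesis using orbits_coverture by simp
qed

lemma (in group) right_mult_action_on_rcosets:
  assumes "subgroup P G" and "subgroup Q G"
  shows "group_action (G\<lparr>carrier := Q\<rparr>) (rcosets P) (\<lambda>x. \<lambda>R\<in>rcosets P. R #> inv x)"
proof -
  let ?\<phi> = "\<lambda>x. \<lambda>R\<in>rcosets P. R #> inv x"
  have P: "P \<subseteq> carrier G" and Q: "Q \<subseteq> carrier G"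
    using assms by (simp_all add: subgroup.subset)
  have R: "R #> x \<in> rcosets P" if "R \<in> rcosets P" "x \<in> carrier G" for R x
    using that P unfolding RCOSETS_def by (auto simp: coset_mult_assoc)
  have Rsub: "R \<subseteq> carrier G" if "R \<in> rcosets P" for R
    using that subgroup.rcosets_carrier[OF assms(1) is_group] by blast
  have bij: "?\<phi> x \<in> Bij (rcosets P)" if x: "x \<in> carrier G" for x
  proof -
    have "bij_betw (?\<phi> x) (rcosets P) (rcosets P)"
      by (rule bij_betw_byWitness[where f' = "\<lambda>R. R #> x"])
        (use x R Rsub in \<open>auto simp: coset_mult_assoc\<close>)
    then show ?thesis by (simp add: Bij_def)
  qed
  have hom: "?\<phi> \<in> hom (G\<lparr>carrier := Q\<rparr>) (BijGroup (rcosets P))"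
  proof (rule homI)
    fix x assume "x \<in> carrier (G\<lparr>carrier := Q\<rparr>)"
    then show "?\<phi> x \<in> carrier (BijGroup (rcosets P))"
      using bij Q by (auto simp: BijGroup_def)
  next
    fix x y assume "x \<in> carrier (G\<lparr>carrier := Q\<rparr>)" "y \<in> carrier (G\<lparr>carrier := Q\<rparr>)"
    then have xy: "x \<in> carrier G" "y \<in> carrier G" using Q by auto
    have "?\<phi> (x \<otimes> y) = compose (rcosets P) (?\<phi> x) (?\<phi> y)"
      using xy R Rsub by (auto simp: fun_eq_iff compose_def coset_mult_assoc inv_mult_group)
    then show "?\<phi> (x \<otimes>\<^bsub>G\<lparr>carrier := Q\<rparr>\<^esub> y) = ?\<phi> x \<otimes>\<^bsub>BijGroup (rcosets P)\<^esub> ?\<phi> y"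
      using bij xy by (simp add: BijGroup_def)
  qed
  show ?thesis
    unfolding group_action_def group_hom_def group_hom_axioms_def
    using hom subgroup.subgroup_is_group[OF assms(2) is_group] group_BijGroup by blast
qed

text \<open>The part of Sylow's second theorem that is needed: a subgroup of prime power order is
  conjugate into any Sylow subgroup, as it fixes one of the cosets of the latter.\<close>

lemma (in group) conjugate_into_sylow:
  assumes "prime r" and "subgroup P G" and "subgroup Q G"
    and "card P = r ^ a" and "card Q = r ^ b" and "Coset.order G = r ^ a * m" and "\<not> r dvd m"
    and "finite (carrier G)"
  shows "\<exists>k\<in>carrier G. \<forall>x\<in>Q. k \<otimes> x \<otimes> inv k \<in> P"
proof -
  interpret A: group_action "G\<lparr>carrier := Q\<rparr>" "rcosets P" "\<lambda>x. \<lambda>R\<in>rcosets P. R #> inv x"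
    using right_mult_action_on_rcosets assms(2,3) .
  have "card (rcosets P) * r ^ a = r ^ a * m"
    using lagrange[OF assms(2)] assms(4,6) by simp
  then have "card (rcosets P) = m" using assms(1) by (simp add: prime_gt_0_nat)
  moreover have "finite (rcosets P)"
    using assms(2,8) by (simp add: RCOSETS_def)
  moreover have "Coset.order (G\<lparr>carrier := Q\<rparr>) = r ^ b"
    using assms(5) by (simp add: Coset.order_def)
  ultimately obtain R where R: "R \<in> rcosets P" "\<And>x. x \<in> Q \<Longrightarrow> R #> inv x = R"
    using A.prime_dvd_card_of_no_fixed_point[OF assms(1), of b] assms(7) by fastforce
  then obtain k where k: "k \<in> carrier G" "R = P #> k"
    unfolding RCOSETS_def by blast
  have "k \<otimes> x \<otimes> inv k \<in> P" if x: "x \<in> Q" for x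
  proof -
    have xG: "x \<in> carrier G" using x assms(3) by (simp add: subgroup.mem_carrier)
    have "k \<in> R" using k assms(2) by (simp add: rcos_self)
    then have "k \<otimes> x \<in> R #> x"
      by (auto simp: r_coset_def)
    also have "R #> x = R"
      using R(2)[of "inv x"] x assms(3) xG by (simp add: subgroup.m_inv_closed)
    finally obtain y where "y \<in> P" "k \<otimes> x = y \<otimes> k"
      using k by (auto simp: r_coset_def)
    then show ?thesis
      using k xG assms(2) by (metis inv_solve_right' m_closed subgroup.mem_carrier)
  qed
  then show ?thesis using k by blast
qed

lemma (in group) conjugate_into_sylow_of_subgroup:
  assumes "prime r" and "subgroup K G" and "finite K"
    and "subgroup P G" and "P \<subseteq> K" and "subgroup Q G" and "Q \<subseteq> K"
    and "card P = r ^ a" and "card Q = r ^ b" and "card K = r ^ a * m" and "\<not> r dvd m"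
  shows "\<exists>k\<in>K. \<forall>x\<in>Q. k \<otimes> x \<otimes> inv k \<in> P"
proof -
  interpret K: group "G\<lparr>carrier := K\<rparr>"
    using subgroup.subgroup_is_group[OF assms(2) is_group] .
  have "\<exists>k\<in>carrier (G\<lparr>carrier := K\<rparr>). \<forall>x\<in>Q.
          k \<otimes>\<^bsub>G\<lparr>carrier := K\<rparr>\<^esub> x \<otimes>\<^bsub>G\<lparr>carrier := K\<rparr>\<^esub> inv\<^bsub>G\<lparr>carrier := K\<rparr>\<^esub> k \<in> P"
    by (rule K.conjugate_into_sylow[OF assms(1) _ _ assms(8,9)])
      (use assms in \<open>simp_all add: subgroup_incl Coset.order_def\<close>)
  then show ?thesis
    using m_inv_consistent[OF assms(2)] by auto
qed


section \<open>Permutation groups acting on a set\<close>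

lemma BijGroup_mult_apply:
  assumes "f \<in> carrier (BijGroup \<Omega>)" and "h \<in> carrier (BijGroup \<Omega>)" and "x \<in> \<Omega>"
  shows "(f \<otimes>\<^bsub>BijGroup \<Omega>\<^esub> h) x = f (h x)"
  using assms by (simp add: BijGroup_def compose_def)

lemma BijGroup_one_apply: "x \<in> \<Omega> \<Longrightarrow> \<one>\<^bsub>BijGroup \<Omega>\<^esub> x = x"
  by (simp add: BijGroup_def)

lemma BijGroup_bij_betw: "f \<in> carrier (BijGroup \<Omega>) \<Longrightarrow> bij_betw f \<Omega> \<Omega>"
  by (simp add: BijGroup_def Bij_def)

lemma BijGroup_apply_in: "f \<in> carrier (BijGroup \<Omega>) \<Longrightarrow> x \<in> \<Omega> \<Longrightarrow> f x \<in> \<Omega>"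
  using BijGroup_bij_betw bij_betwE by blast

lemma BijGroup_eqI:
  assumes "f \<in> carrier (BijGroup \<Omega>)" and "h \<in> carrier (BijGroup \<Omega>)"
    and "\<And>x. x \<in> \<Omega> \<Longrightarrow> f x = h x"
  shows "f = h"
  using assms by (auto simp: BijGroup_def Bij_def intro: extensionalityI)

lemma BijGroup_inv_apply:
  assumes "f \<in> carrier (BijGroup \<Omega>)" and "x \<in> \<Omega>"
  shows "(inv\<^bsub>BijGroup \<Omega>\<^esub> f) (f x) = x" and "f ((inv\<^bsub>BijGroup \<Omega>\<^esub> f) x) = x"
proof -
  interpret S: group "BijGroup \<Omega>" by (rule group_BijGroup)
  show "(inv\<^bsub>BijGroup \<Omega>\<^esub> f) (f x) = x"
    using BijGroup_mult_apply[of "inv\<^bsub>BijGroup \<Omega>\<^esub> f" \<Omega> f x] assms by (simp add: BijGroup_one_apply)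
  show "f ((inv\<^bsub>BijGroup \<Omega>\<^esub> f) x) = x"
    using BijGroup_mult_apply[of f \<Omega> "inv\<^bsub>BijGroup \<Omega>\<^esub> f" x] assms by (simp add: BijGroup_one_apply)
qed

lemma BijGroup_pow_apply:
  assumes "f \<in> carrier (BijGroup \<Omega>)" and "x \<in> \<Omega>"
  shows "(f [^]\<^bsub>BijGroup \<Omega>\<^esub> (n::nat)) x = (f ^^ n) x"
proof -
  interpret S: group "BijGroup \<Omega>" by (rule group_BijGroup)
  show ?thesis
    using assms(2)
  proof (induction n arbitrary: x)
    case (Suc n)
    then show ?case
      using BijGroup_apply_in[OF assms(1) Suc.prems]
      by (simp add: BijGroup_mult_apply assms(1) funpow_Suc_right del: funpow.simps(2))
  qed (simp add: BijGroup_one_apply)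
qed

lemma finite_BijGroup: "finite \<Omega> \<Longrightarrow> finite (carrier (BijGroup \<Omega>))"
  by (rule finite_subset[of _ "\<Omega> \<rightarrow>\<^sub>E \<Omega>"])
    (auto simp: BijGroup_def Bij_def extensional_def dest: bij_betw_apply intro: finite_PiE)

lemma perm_group_action:
  assumes "subgroup H (BijGroup \<Omega>)"
  shows "group_action (perm_group \<Omega> H) \<Omega> (\<lambda>g. g)"
proof -
  have "H \<subseteq> carrier (BijGroup \<Omega>)" using assms by (rule subgroup.subset)
  then have "(\<lambda>g. g) \<in> hom (perm_group \<Omega> H) (BijGroup \<Omega>)"
    by (auto simp: hom_def perm_group_def)
  then show ?thesis
    unfolding group_action_def group_hom_def group_hom_axioms_def
    using subgroup.subgroup_is_group[OF assms group_BijGroup] group_BijGroup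
    by (auto simp: perm_group_def)
qed

lemma transitive_on_iff:
  assumes "subgroup H (BijGroup \<Omega>)"
  shows "transitive_on \<Omega> H \<longleftrightarrow> (\<forall>x\<in>\<Omega>. \<forall>y\<in>\<Omega>. \<exists>g\<in>H. g x = y)"
  unfolding transitive_on_def transitive_action_def transitive_action_axioms_def
  using perm_group_action[OF assms] by (auto simp: perm_group_def)

lemma card_orbit_mult_card_stabilizer:
  assumes "subgroup H (BijGroup \<Omega>)" and "x \<in> \<Omega>"
  shows "card ((\<lambda>g. g x) ` H) * card (stabilizer (perm_group \<Omega> H) (\<lambda>g. g) x) = card H"
  using group_action.orbit_stabilizer_theorem[OF perm_group_action[OF assms(1)] assms(2)]
  by (simp add: orbit_def perm_group_def Coset.order_def image_def Bex_def conj_commute)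

lemma (in group) subgroup_of_finite_mult_closed:
  assumes "H \<subseteq> carrier G" and "finite H" and "H \<noteq> {}"
    and "\<And>x y. x \<in> H \<Longrightarrow> y \<in> H \<Longrightarrow> x \<otimes> y \<in> H"
  shows "subgroup H G"
proof (rule subgroupI)
  fix x assume x: "x \<in> H"
  have inj: "inj_on (\<lambda>y. x \<otimes> y) H"
    using assms(1) x by (intro inj_onI) (metis Units_eq Units_l_cancel subsetD)
  then have surj: "(\<lambda>y. x \<otimes> y) ` H = H"
    using endo_inj_surj assms(2,4) x by (metis image_subsetI)
  then obtain e where e: "e \<in> H" "x \<otimes> e = x"
    using x by (metis imageE)
  then have "e = \<one>" using assms(1) x by (metis l_cancel_one subsetD)
  with surj e(1) obtain y where "y \<in> H" "x \<otimes> y = \<one>"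
    by (metis imageE)
  then show "inv x \<in> H" using assms(1) x by (metis inv_equality inv_comm subsetD)
qed (use assms in auto)


section \<open>Blocks of prime size\<close>

text \<open>A transitive group \<open>G\<close> with an invariant partition \<open>\<B>\<close> of \<open>\<Omega>\<close> into \<open>p\<close> sets of
  size \<open>q\<close>, with a nontrivial kernel, such that no proper subgroup of \<open>G\<close> is
  transitive.\<close>

locale minimal_imprimitive_group =
  fixes p q :: nat and \<Omega> :: "'a set" and G :: "('a \<Rightarrow> 'a) set" and \<B> :: "'a set set"
  assumes prime_p: "prime p" and prime_q: "prime q" and q_less_p: "q < p"
    and finite_Omega: "finite \<Omega>"
    and G: "subgroup G (BijGroup \<Omega>)"
    and transitive: "\<And>x y. x \<in> \<Omega> \<Longrightarrow> y \<in> \<Omega> \<Longrightarrow> \<exists>g\<in>G. g x = y"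
    and partition: "partition_on \<Omega> \<B>"
    and invariant: "\<And>g B. g \<in> G \<Longrightarrow> B \<in> \<B> \<Longrightarrow> g ` B \<in> \<B>"
    and card_B: "\<And>B. B \<in> \<B> \<Longrightarrow> card B = q"
    and card_blocks: "card \<B> = p"
    and nontrivial: "\<exists>g\<in>G. (\<forall>B\<in>\<B>. g ` B = B) \<and> (\<exists>x\<in>\<Omega>. g x \<noteq> x)"
    and minimal: "\<And>H. subgroup H (BijGroup \<Omega>) \<Longrightarrow> H \<subseteq> G \<Longrightarrow>
      (\<And>x y. x \<in> \<Omega> \<Longrightarrow> y \<in> \<Omega> \<Longrightarrow> \<exists>g\<in>H. g x = y) \<Longrightarrow> H = G"
begin

sublocale S: group "BijGroup \<Omega>"
  by (rule group_BijGroup)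

abbreviation "S \<equiv> BijGroup \<Omega>"

lemma G_carrier: "g \<in> G \<Longrightarrow> g \<in> carrier S"
  using G subgroup.mem_carrier by metis

lemma G_mult: "g \<in> G \<Longrightarrow> h \<in> G \<Longrightarrow> g \<otimes>\<^bsub>S\<^esub> h \<in> G"
  using G subgroup.m_closed by metis

lemma G_inv: "g \<in> G \<Longrightarrow> inv\<^bsub>S\<^esub> g \<in> G"
  using G subgroup.m_inv_closed by metis

lemma G_pow: "g \<in> G \<Longrightarrow> g [^]\<^bsub>S\<^esub> (n::nat) \<in> G"
  by (induction n) (auto simp: G_mult subgroup.one_closed[OF G])

lemma finite_S: "finite (carrier S)"
  using finite_BijGroup finite_Omega .

lemma finite_G: "finite G"
  using finite_S G_carrier by (meson finite_subset subsetI)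

lemma B_subset: "B \<in> \<B> \<Longrightarrow> B \<subseteq> \<Omega>"
  using partition by (auto simp: partition_on_def)

lemma finite_B: "B \<in> \<B> \<Longrightarrow> finite B"
  using B_subset finite_Omega finite_subset by blast

lemma finite_blocks: "finite \<B>"
  using card_blocks prime_p by (metis card.infinite not_prime_0)

lemma B_disjoint: "B \<in> \<B> \<Longrightarrow> B' \<in> \<B> \<Longrightarrow> x \<in> B \<Longrightarrow> x \<in> B' \<Longrightarrow> B = B'"
  using partition by (auto simp: partition_on_def disjoint_def)

lemma block_of: "x \<in> \<Omega> \<Longrightarrow> \<exists>B\<in>\<B>. x \<in> B"
  using partition by (auto simp: partition_on_def)

lemma mult_image:
  assumes "g \<in> carrier S" and "h \<in> carrier S" and "B \<subseteq> \<Omega>"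
  shows "(g \<otimes>\<^bsub>S\<^esub> h) ` B = g ` h ` B"
  using assms BijGroup_mult_apply[OF assms(1,2)] by (force simp: image_image)

lemma pow_image:
  assumes "g \<in> carrier S" and "B \<subseteq> \<Omega>"
  shows "(g [^]\<^bsub>S\<^esub> (n::nat)) ` B = ((\<lambda>A. g ` A) ^^ n) B"
  unfolding funpow_image using BijGroup_pow_apply[OF assms(1)] assms(2)
  by (intro image_cong) auto

lemma inv_image_eq:
  assumes "g \<in> carrier S" and "B \<subseteq> \<Omega>"
  shows "(inv\<^bsub>S\<^esub> g) ` g ` B = B" "g ` (inv\<^bsub>S\<^esub> g) ` B = B"
  using assms BijGroup_inv_apply[OF assms(1)] by (force simp: image_image)+

lemma image_eq_of_point:
  assumes "g \<in> G" and "B \<in> \<B>" and "B' \<in> \<B>" and "x \<in> B" and "g x \<in> B'"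
  shows "g ` B = B'"
  by (rule B_disjoint[OF invariant[OF assms(1,2)] assms(3) imageI[OF assms(4)] assms(5)])

text \<open>The kernel of the action of \<open>G\<close> on the set of blocks.\<close>

definition K :: "('a \<Rightarrow> 'a) set" where
  "K = {g \<in> G. \<forall>B\<in>\<B>. g ` B = B}"

lemma K_subset: "K \<subseteq> G" by (auto simp: K_def)

lemma K_image: "k \<in> K \<Longrightarrow> B \<in> \<B> \<Longrightarrow> k ` B = B" by (auto simp: K_def)

lemma K_apply: "k \<in> K \<Longrightarrow> B \<in> \<B> \<Longrightarrow> x \<in> B \<Longrightarrow> k x \<in> B"
  using K_image by blast

lemma finite_K: "finite K"
  using finite_G K_subset finite_subset by blast

lemma K_carrier: "k \<in> K \<Longrightarrow> k \<in> carrier S"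
  using K_subset G_carrier by blast

lemma K_subgroup: "subgroup K S"
proof (rule S.subgroup_of_finite_mult_closed)
  have "\<one>\<^bsub>S\<^esub> ` B = B" if "B \<in> \<B>" for B
  proof -
    have "\<one>\<^bsub>S\<^esub> ` B = (\<lambda>x. x) ` B"
      using B_subset[OF that] by (intro image_cong refl BijGroup_one_apply) blast
    then show ?thesis by simp
  qed
  then show "K \<noteq> {}" using subgroup.one_closed[OF G] by (auto simp: K_def)
  show "x \<otimes>\<^bsub>S\<^esub> y \<in> K" if "x \<in> K" "y \<in> K" for x y
  proof -
    have "(x \<otimes>\<^bsub>S\<^esub> y) ` B = B" if "B \<in> \<B>" for B
      using mult_image[OF K_carrier K_carrier B_subset] K_image \<open>x \<in> K\<close> \<open>y \<in> K\<close> that by metis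
    moreover have "x \<otimes>\<^bsub>S\<^esub> y \<in> G"
      using that G_mult K_subset by (meson subsetD)
    ultimately show ?thesis by (simp add: K_def)
  qed
qed (use finite_K K_carrier in auto)

lemma conj_in_K:
  assumes "g \<in> G" and "k \<in> K"
  shows "g \<otimes>\<^bsub>S\<^esub> k \<otimes>\<^bsub>S\<^esub> inv\<^bsub>S\<^esub> g \<in> K"
proof -
  have "(g \<otimes>\<^bsub>S\<^esub> k \<otimes>\<^bsub>S\<^esub> inv\<^bsub>S\<^esub> g) ` B = B" if B: "B \<in> \<B>" for B
  proof -
    have "(g \<otimes>\<^bsub>S\<^esub> k \<otimes>\<^bsub>S\<^esub> inv\<^bsub>S\<^esub> g) ` B = g ` k ` (inv\<^bsub>S\<^esub> g) ` B"
      using assms B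
      by (simp add: mult_image G_carrier K_carrier B_subset invariant G_inv)
    also have "\<dots> = g ` (inv\<^bsub>S\<^esub> g) ` B"
      using K_image[OF assms(2) invariant[OF G_inv[OF assms(1)] B]] by simp
    also have "\<dots> = B" using inv_image_eq assms G_carrier B_subset B by simp
    finally show ?thesis .
  qed
  then show ?thesis
    using assms K_subset by (auto simp: K_def G_mult G_inv)
qed

lemma K_moves:
  assumes "x \<in> \<Omega>"
  shows "\<exists>k\<in>K. k x \<noteq> x"
proof -
  obtain k y where k: "k \<in> K" "y \<in> \<Omega>" "k y \<noteq> y"
    using nontrivial by (auto simp: K_def)
  obtain g where g: "g \<in> G" "g y = x" using transitive k(2) assms by blast
  have "(g \<otimes>\<^bsub>S\<^esub> k \<otimes>\<^bsub>S\<^esub> inv\<^bsub>S\<^esub> g) x = g (k y)"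
    using g(1) k(1,2) BijGroup_inv_apply(1)[OF G_carrier[OF g(1)] k(2)]
    by (simp add: BijGroup_mult_apply BijGroup_apply_in G_carrier K_carrier flip: g(2))
  moreover have "g (k y) \<noteq> g y"
    using k BijGroup_bij_betw[OF G_carrier[OF g(1)]] BijGroup_apply_in[OF K_carrier[OF k(1)] k(2)]
    by (auto simp: bij_betw_def inj_on_def)
  ultimately show ?thesis using conj_in_K[OF g(1) k(1)] g(2) by metis
qed

text \<open>The orbit of a point under the kernel.\<close>

abbreviation "orb x \<equiv> (\<lambda>k. k x) ` K"

lemma orb_eq:
  assumes "x \<in> \<Omega>" and "y \<in> orb x"
  shows "orb y = orb x"
proof -
  obtain k where k: "k \<in> K" "y = k x" using assms by blast
  have sub: "orb (k x) \<subseteq> orb x" if "k \<in> K" "x \<in> \<Omega>" for k x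
  proof
    fix z assume "z \<in> orb (k x)"
    then obtain h where h: "h \<in> K" "z = h (k x)" by blast
    then have "z = (h \<otimes>\<^bsub>S\<^esub> k) x" using BijGroup_mult_apply that K_carrier by metis
    then show "z \<in> orb x" using subgroup.m_closed[OF K_subgroup h(1) that(1)] by blast
  qed
  have "x = (inv\<^bsub>S\<^esub> k) y" using k assms BijGroup_inv_apply K_carrier by metis
  moreover have "inv\<^bsub>S\<^esub> k \<in> K" using k K_subgroup subgroup.m_inv_closed by metis
  moreover have "y \<in> \<Omega>" using k assms BijGroup_apply_in K_carrier by metis
  ultimately show ?thesis using sub[of k x] sub[of "inv\<^bsub>S\<^esub> k" y] k assms by auto
qed

lemma card_orb:
  assumes "x \<in> \<Omega>" and "y \<in> \<Omega>"
  shows "card (orb x) \<le> card (orb y)"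
proof -
  obtain g where g: "g \<in> G" "g y = x" using transitive assms by blast
  have "orb x \<subseteq> g ` orb y"
  proof
    fix z assume "z \<in> orb x"
    then obtain k where k: "k \<in> K" "z = k x" by blast
    define h where "h = inv\<^bsub>S\<^esub> g \<otimes>\<^bsub>S\<^esub> k \<otimes>\<^bsub>S\<^esub> g"
    have "h \<in> K" using conj_in_K[OF G_inv[OF g(1)] k(1)] g(1) by (simp add: h_def G_carrier)
    moreover have "h y = (inv\<^bsub>S\<^esub> g) (k x)"
      unfolding h_def using g k(1) assms
      by (simp add: BijGroup_mult_apply BijGroup_apply_in G_carrier K_carrier)
    then have "g (h y) = z"
      using k g(1) assms by (simp add: BijGroup_inv_apply(2) BijGroup_apply_in G_carrier K_carrier)
    ultimately show "z \<in> g ` orb y" by blast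
  qed
  then have "card (orb x) \<le> card (g ` orb y)" using finite_K by (intro card_mono) auto
  also have "\<dots> \<le> card (orb y)" using finite_K by (intro card_image_le) auto
  finally show ?thesis .
qed

text \<open>The orbits of the normal subgroup \<open>K\<close> on a block all have the same size, which divides the
  prime \<open>q\<close> and is not \<open>1\<close>.\<close>

lemma K_transitive_on_block:
  assumes "B \<in> \<B>" and "x \<in> B"
  shows "orb x = B"
proof -
  have xO: "x \<in> \<Omega>" using assms B_subset by blast
  have sub: "orb y \<subseteq> B" if "y \<in> B" for y
    using K_apply[OF _ assms(1) that] by blast
  have self: "y \<in> orb y" if "y \<in> \<Omega>" for y
    using subgroup.one_closed[OF K_subgroup] BijGroup_one_apply[OF that] by (metis imageI)
  have Un: "\<Union> (orb ` B) = B"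
  proof
    show "\<Union> (orb ` B) \<subseteq> B" using sub by (rule UN_least)
    show "B \<subseteq> \<Union> (orb ` B)"
    proof
      fix y assume y: "y \<in> B"
      then have "y \<in> orb y" using self B_subset[OF assms(1)] by (meson subsetD)
      then show "y \<in> \<Union> (orb ` B)" using y by (rule UN_I[rotated])
    qed
  qed
  have "card (orb x) * card (orb ` B) = card (\<Union> (orb ` B))"
  proof (rule card_partition)
    show "finite (orb ` B)" "finite (\<Union> (orb ` B))"
      using Un finite_B[OF assms(1)] by auto
    show "card c = card (orb x)" if "c \<in> orb ` B" for c
      using that card_orb xO B_subset[OF assms(1)] by (metis (no_types, lifting) imageE le_antisym subsetD)
    show "c1 \<inter> c2 = {}" if c: "c1 \<in> orb ` B" "c2 \<in> orb ` B" "c1 \<noteq> c2" for c1 c2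
    proof (rule ccontr)
      assume "c1 \<inter> c2 \<noteq> {}"
      then obtain z where z: "z \<in> c1" "z \<in> c2" by blast
      have "orb z = d" if "d \<in> orb ` B" "z \<in> d" for d
      proof -
        obtain y where "y \<in> B" "d = orb y" using \<open>d \<in> orb ` B\<close> by (rule imageE)
        then show ?thesis using orb_eq[of y z] that(2) B_subset[OF assms(1)] by (metis subsetD)
      qed
      then show False using z c by metis
    qed
  qed
  then have "card (orb x) dvd q" using Un card_B[OF assms(1)] by (metis dvd_triv_left)
  moreover have "card (orb x) \<noteq> 1"
  proof
    assume "card (orb x) = 1"
    then obtain z where "orb x = {z}" by (rule card_1_singletonE)
    then show False using K_moves[OF xO] self[OF xO] by auto
  qed
  ultimately have "card (orb x) = card B"
    using prime_q card_B[OF assms(1)] by (metis prime_nat_iff)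
  then show ?thesis using sub[OF assms(2)] finite_B[OF assms(1)] card_subset_eq by blast
qed

lemma q_dvd_card_K: "q dvd card K"
proof -
  obtain B where B: "B \<in> \<B>" using card_blocks prime_p by (metis card.empty ex_in_conv not_prime_0)
  then obtain x where x: "x \<in> B" using card_B prime_q by (metis card.empty ex_in_conv not_prime_0)
  have "card (orb x) dvd card K"
    using card_orbit_mult_card_stabilizer[OF K_subgroup] B x B_subset by (metis dvd_triv_left subsetD)
  then show ?thesis using K_transitive_on_block[OF B x] card_B[OF B] by simp
qed

end


lemma (in group) pow_card_subgroup_eq_one:
  assumes "subgroup H G" and "x \<in> H"
  shows "x [^] card H = \<one>"
  using group.pow_order_eq_1[OF subgroup.subgroup_is_group[OF assms(1) is_group], of x] assms(2)
  by (simp add: Coset.order_def flip: nat_pow_consistent)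

lemma (in group) cauchy:
  assumes "prime r" and "subgroup H G" and "finite H" and "r dvd card H"
  shows "\<exists>x\<in>H. x \<noteq> \<one> \<and> x [^] r = \<one>"
proof -
  obtain m where "card H = r ^ 1 * m" using assms(4) by auto
  then obtain A where A: "subgroup A (G\<lparr>carrier := H\<rparr>)" "card A = r"
    using sylow_thm[OF assms(1) subgroup.subgroup_is_group[OF assms(2) is_group], of 1 m] assms(3)
    by (auto simp: Coset.order_def)
  have AG: "subgroup A G" using incl_subgroup[OF assms(2) A(1)] .
  have "A \<noteq> {\<one>}" using A(2) prime_gt_1_nat[OF assms(1)] by auto
  then obtain x where "x \<in> A" "x \<noteq> \<one>" using subgroup.one_closed[OF AG] by blast
  moreover have "A \<subseteq> H" using subgroup.subset[OF A(1)] by simp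
  ultimately show ?thesis using pow_card_subgroup_eq_one[OF AG] A(2) by blast
qed

lemma (in group) conj_mult:
  assumes "g \<in> carrier G" and "x \<in> carrier G" and "y \<in> carrier G"
  shows "g \<otimes> (x \<otimes> y) \<otimes> inv g = (g \<otimes> x \<otimes> inv g) \<otimes> (g \<otimes> y \<otimes> inv g)"
proof -
  have "(g \<otimes> x \<otimes> inv g) \<otimes> (g \<otimes> y \<otimes> inv g) = g \<otimes> x \<otimes> (inv g \<otimes> g) \<otimes> y \<otimes> inv g"
    using assms by (simp only: m_assoc m_closed inv_closed)
  then show ?thesis using assms by (simp add: m_assoc)
qed

lemma (in group) conj_image_subgroup:
  assumes "subgroup P G" and "finite P" and "g \<in> carrier G"
  shows "subgroup ((\<lambda>x. g \<otimes> x \<otimes> inv g) ` P) G"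
    and "card ((\<lambda>x. g \<otimes> x \<otimes> inv g) ` P) = card P"
proof -
  have P: "x \<in> carrier G" if "x \<in> P" for x using that assms(1) subgroup.mem_carrier by metis
  show "subgroup ((\<lambda>x. g \<otimes> x \<otimes> inv g) ` P) G"
  proof (rule subgroup_of_finite_mult_closed)
    show "(\<lambda>x. g \<otimes> x \<otimes> inv g) ` P \<noteq> {}" using subgroup.one_closed[OF assms(1)] by blast
    fix x y
    assume "x \<in> (\<lambda>x. g \<otimes> x \<otimes> inv g) ` P" "y \<in> (\<lambda>x. g \<otimes> x \<otimes> inv g) ` P"
    then obtain u v where "u \<in> P" "v \<in> P" "x = g \<otimes> u \<otimes> inv g" "y = g \<otimes> v \<otimes> inv g"
      by blast
    then show "x \<otimes> y \<in> (\<lambda>x. g \<otimes> x \<otimes> inv g) ` P"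
      using conj_mult[OF assms(3) P P, of u v] subgroup.m_closed[OF assms(1)] by (metis imageI)
  qed (use assms P in auto)
  have "inj_on (\<lambda>x. g \<otimes> x \<otimes> inv g) P"
    using assms(3) P by (auto intro!: inj_onI dest: conjugation_is_inj)
  then show "card ((\<lambda>x. g \<otimes> x \<otimes> inv g) ` P) = card P" by (rule card_image)
qed

lemma (in group) conj_pow_mem:
  assumes "H \<subseteq> carrier G" and "g \<in> carrier G" and "\<And>x. x \<in> H \<Longrightarrow> g \<otimes> x \<otimes> inv g \<in> H"
    and "x \<in> H"
  shows "g [^] (n::nat) \<otimes> x \<otimes> inv (g [^] n) \<in> H"
proof (induction n)
  case 0
  then show ?case using assms by auto
next
  case (Suc n)
  have "g [^] Suc n \<otimes> x \<otimes> inv (g [^] Suc n)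
      = g \<otimes> (g [^] n \<otimes> x \<otimes> inv (g [^] n)) \<otimes> inv g"
    using assms(1,2,4)
    unfolding nat_pow_Suc2[OF assms(2)] by (simp add: m_assoc inv_mult_group subsetD)
  then show ?case using assms(3)[OF Suc.IH] by simp
qed

context minimal_imprimitive_group
begin

lemma card_Omega: "card \<Omega> = p * q"
proof -
  have "q * card \<B> = card (\<Union>\<B>)"
    by (rule card_partition)
      (use finite_blocks finite_Omega partition card_B in
        \<open>auto simp: partition_on_def disjoint_def\<close>)
  then show ?thesis
    using partition card_blocks by (simp add: partition_on_def mult.commute)
qed

lemma block_nonempty: "B \<in> \<B> \<Longrightarrow> B \<noteq> {}"
  using card_B prime_q by (metis card.empty not_prime_0)

lemma card_G_eq:
  assumes "x \<in> \<Omega>"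
  shows "p * q * card (stabilizer (perm_group \<Omega> G) (\<lambda>g. g) x) = card G"
proof -
  have "(\<lambda>g. g x) ` G = \<Omega>"
    using transitive[OF assms] BijGroup_apply_in[OF G_carrier assms] by blast
  then show ?thesis
    using card_orbit_mult_card_stabilizer[OF G assms] card_Omega by simp
qed

lemma coprime_below_prime_power:
  assumes "prime r" and "0 < i" and "i < (r::nat)"
  shows "coprime i (r ^ a)"
  using assms by (metis coprime_commute coprime_power_right_iff dvd_imp_le leD prime_imp_coprime)

lemma funpow_eq_of_pow_eq_one:
  assumes "x \<in> carrier S" and "x [^]\<^bsub>S\<^esub> (n::nat) = \<one>\<^bsub>S\<^esub>" and "\<omega> \<in> \<Omega>"
  shows "(x ^^ n) \<omega> = \<omega>"
  using BijGroup_pow_apply[OF assms(1,3), of n] assms(2,3) BijGroup_one_apply by metis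

text \<open>On the \<open>q - 1\<close> points of a block other than a fixed point there is no room for a nontrivial cycle
  of \<open>q\<close>-power length.\<close>

lemma fixes_block_of_fixed_point:
  assumes "x \<in> K" and "x [^]\<^bsub>S\<^esub> (q ^ a) = \<one>\<^bsub>S\<^esub>"
    and "B \<in> \<B>" and "\<omega> \<in> B" and "x \<omega> = \<omega>" and "y \<in> B"
  shows "x y = y"
proof (cases "y = \<omega>")
  case False
  have inj: "inj_on x \<Omega>" using BijGroup_bij_betw[OF K_carrier[OF assms(1)]] by (simp add: bij_betw_def)
  show ?thesis
  proof (rule periodic_map_trivial[where f = x and B = "B - {\<omega>}" and m = q and n = "q ^ a"])
    show "x ` (B - {\<omega>}) \<subseteq> B - {\<omega>}"
    proof
      fix z assume "z \<in> x ` (B - {\<omega>})"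
      then obtain w where w: "w \<in> B" "w \<noteq> \<omega>" "z = x w" by blast
      then have "z \<noteq> \<omega>"
        using inj_onD[OF inj, of w \<omega>] assms(3,4,5) B_subset by auto
      then show "z \<in> B - {\<omega>}" using w K_apply[OF assms(1,3)] by blast
    qed
    show "card (B - {\<omega>}) < q"
      using card_B[OF assms(3)] assms(4) finite_B[OF assms(3)] prime_gt_0_nat[OF prime_q] by simp
    show "(x ^^ (q ^ a)) y = y"
      using funpow_eq_of_pow_eq_one[OF K_carrier[OF assms(1)] assms(2)] assms(3,6) B_subset by blast
  qed (use False assms finite_B prime_q coprime_below_prime_power[OF prime_q] prime_gt_0_nat in auto)
qed (use assms in simp)

text \<open>A block has \<open>q < p\<close> points, too few for a nontrivial cycle of \<open>p\<close>-power length.\<close>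

lemma K_no_p_elements:
  assumes "x \<in> K" and "x [^]\<^bsub>S\<^esub> (p ^ a) = \<one>\<^bsub>S\<^esub>"
  shows "x = \<one>\<^bsub>S\<^esub>"
proof (rule BijGroup_eqI)
  fix \<omega> assume w: "\<omega> \<in> \<Omega>"
  obtain B where B: "B \<in> \<B>" "\<omega> \<in> B" using block_of w by blast
  have "x \<omega> = \<omega>"
  proof (rule periodic_map_trivial[where f = x and B = B and m = p and n = "p ^ a"])
    show "x ` B \<subseteq> B" using K_image[OF assms(1) B(1)] by simp
    show "(x ^^ (p ^ a)) \<omega> = \<omega>"
      using funpow_eq_of_pow_eq_one[OF K_carrier[OF assms(1)] assms(2) w] .
  qed (use B finite_B card_B q_less_p coprime_below_prime_power[OF prime_p] prime_gt_0_nat[OF prime_p] in auto)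
  then show "x \<omega> = \<one>\<^bsub>S\<^esub> \<omega>" using BijGroup_one_apply w by metis
qed (use K_carrier[OF assms(1)] in auto)

text \<open>An element of \<open>G\<close> that moves some block, and whose \<open>p\<close>-th power fixes all blocks, permutes the
  blocks in a single cycle; it is called a rotation below.\<close>

lemma rotation_blocks:
  assumes "g \<in> G" and "g [^]\<^bsub>S\<^esub> p \<in> K" and "B\<^sub>1 \<in> \<B>" and "g ` B\<^sub>1 \<noteq> B\<^sub>1" and "B \<in> \<B>"
  shows "\<B> = (\<lambda>i. ((\<lambda>A. g ` A) ^^ i) B) ` {..<p}" and "g ` B \<noteq> B"
proof -
  have per: "((\<lambda>A. g ` A) ^^ p) A = A" if "A \<in> \<B>" for A
    using pow_image[OF G_carrier[OF assms(1)] B_subset[OF that], of p] K_image[OF assms(2) that]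
    by simp
  have cyc: "\<B> = (\<lambda>i. ((\<lambda>A. g ` A) ^^ i) A) ` {..<p}" if "A \<in> \<B>" "g ` A \<noteq> A" for A
  proof (rule periodic_map_cyclic[where n = p])
    show "(\<lambda>A. g ` A) ` \<B> \<subseteq> \<B>" using invariant[OF assms(1)] by blast
    show "coprime i p" if "0 < i" "i < p" for i
      using coprime_below_prime_power[OF prime_p that, of 1] by simp
  qed (use that finite_blocks card_blocks per prime_gt_0_nat[OF prime_p] in auto)
  show moved: "g ` B \<noteq> B"
  proof
    assume fix_B: "g ` B = B"
    obtain i where i: "i < p" "B = ((\<lambda>A. g ` A) ^^ i) B\<^sub>1"
      using cyc[OF assms(3,4)] assms(5) by blast
    have "((\<lambda>A. g ` A) ^^ j) B = B" for j using fix_B by (induction j) auto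
    then have "B = ((\<lambda>A. g ` A) ^^ (p - i)) B" by simp
    also have "\<dots> = ((\<lambda>A. g ` A) ^^ (p - i + i)) B\<^sub>1"
      unfolding i(2) by (simp only: funpow_add o_apply)
    also have "\<dots> = B\<^sub>1" using i per[OF assms(3)] by simp
    finally show False using assms(4) fix_B by simp
  qed
  show "\<B> = (\<lambda>i. ((\<lambda>A. g ` A) ^^ i) B) ` {..<p}" using cyc[OF assms(5) moved] .
qed

lemma exists_rotation: "\<exists>g\<in>G. g [^]\<^bsub>S\<^esub> p \<in> K \<and> (\<exists>B\<in>\<B>. g ` B \<noteq> B)"
proof -
  have "\<B> \<noteq> {}" using card_blocks prime_p by auto
  then obtain x where x: "x \<in> \<Omega>"
    using block_nonempty B_subset by blast
  have "p dvd card G" using card_G_eq[OF x] by (metis dvd_triv_left mult.assoc)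
  then obtain g where g: "g \<in> G" "g \<noteq> \<one>\<^bsub>S\<^esub>" "g [^]\<^bsub>S\<^esub> p = \<one>\<^bsub>S\<^esub>"
    using S.cauchy[OF prime_p G finite_G] by blast
  have "g \<notin> K" using K_no_p_elements[of g 1] g by auto
  then have "\<exists>B\<in>\<B>. g ` B \<noteq> B" using g(1) by (auto simp: K_def)
  moreover have "g [^]\<^bsub>S\<^esub> p \<in> K" using g(3) subgroup.one_closed[OF K_subgroup] by simp
  ultimately show ?thesis using g(1) by blast
qed

text \<open>By the Frattini argument a rotation of the blocks can be chosen to normalize a Sylow
  \<open>q\<close>-subgroup of the kernel; replacing it by a power makes its order \<open>p\<close>.\<close>

lemma exists_sylow_normalized_by_rotation:
  "\<exists>P g a. subgroup P S \<and> P \<subseteq> K \<and> card P = q ^ a \<and> 0 < a \<and>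
     g \<in> G \<and> g [^]\<^bsub>S\<^esub> p = \<one>\<^bsub>S\<^esub> \<and> (\<exists>B\<in>\<B>. g ` B \<noteq> B) \<and>
     (\<forall>x\<in>P. g \<otimes>\<^bsub>S\<^esub> x \<otimes>\<^bsub>S\<^esub> inv\<^bsub>S\<^esub> g \<in> P)"
proof -
  have K_pos: "card K \<noteq> 0" using finite_K subgroup.one_closed[OF K_subgroup] by auto
  define a where "a = multiplicity q (card K)"
  obtain m where m: "card K = q ^ a * m" "\<not> q dvd m"
    using multiplicity_decompose'[of "card K" q] K_pos prime_q unfolding a_def
    by (metis not_prime_unit)
  have a: "0 < a" using m q_dvd_card_K by (cases a) auto
  obtain P where P': "subgroup P (S\<lparr>carrier := K\<rparr>)" "card P = q ^ a"
    using sylow_thm[OF prime_q subgroup.subgroup_is_group[OF K_subgroup S.is_group], of a m]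
      m finite_K by (auto simp: Coset.order_def)
  have P: "subgroup P S" "P \<subseteq> K"
    using S.incl_subgroup[OF K_subgroup P'(1)] subgroup.subset[OF P'(1)] by auto
  have finP: "finite P" using P(2) finite_K finite_subset by blast
  obtain g B\<^sub>1 where g: "g \<in> G" "g [^]\<^bsub>S\<^esub> p \<in> K" "B\<^sub>1 \<in> \<B>" "g ` B\<^sub>1 \<noteq> B\<^sub>1"
    using exists_rotation by blast
  let ?Q = "(\<lambda>x. g \<otimes>\<^bsub>S\<^esub> x \<otimes>\<^bsub>S\<^esub> inv\<^bsub>S\<^esub> g) ` P"
  have "?Q \<subseteq> K" using conj_in_K[OF g(1)] P(2) by blast
  then obtain k where k: "k \<in> K" "\<forall>x\<in>?Q. k \<otimes>\<^bsub>S\<^esub> x \<otimes>\<^bsub>S\<^esub> inv\<^bsub>S\<^esub> k \<in> P"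
    using S.conjugate_into_sylow_of_subgroup[OF prime_q K_subgroup finite_K P _ _ P'(2) _ m, of ?Q a]
      S.conj_image_subgroup[OF P(1) finP G_carrier[OF g(1)]] P'(2) by metis
  \<comment> \<open>The element \<open>k\<close> of the kernel corrects \<open>g\<close> so that it normalizes \<open>P\<close>.\<close>
  define n where "n = k \<otimes>\<^bsub>S\<^esub> g"
  have kS: "k \<in> carrier S" and gS: "g \<in> carrier S" using k g K_carrier G_carrier by auto
  have n: "n \<in> G" unfolding n_def using k g K_subset G_mult by blast
  have nP: "n \<otimes>\<^bsub>S\<^esub> x \<otimes>\<^bsub>S\<^esub> inv\<^bsub>S\<^esub> n \<in> P" if "x \<in> P" for x
  proof -
    have "x \<in> carrier S" using that P(1) subgroup.mem_carrier by metis
    then have "n \<otimes>\<^bsub>S\<^esub> x \<otimes>\<^bsub>S\<^esub> inv\<^bsub>S\<^esub> n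
        = k \<otimes>\<^bsub>S\<^esub> (g \<otimes>\<^bsub>S\<^esub> x \<otimes>\<^bsub>S\<^esub> inv\<^bsub>S\<^esub> g) \<otimes>\<^bsub>S\<^esub> inv\<^bsub>S\<^esub> k"
      unfolding n_def using kS gS by (simp add: S.m_assoc S.inv_mult_group)
    then show ?thesis using k(2) that by simp
  qed
  have n_image: "n ` B = g ` B" if "B \<in> \<B>" for B
    unfolding n_def
    using mult_image[OF kS gS B_subset[OF that]] K_image[OF k(1) invariant[OF g(1) that]] by simp
  have pow_image_eq: "((\<lambda>A. n ` A) ^^ i) B = ((\<lambda>A. g ` A) ^^ i) B \<and> ((\<lambda>A. g ` A) ^^ i) B \<in> \<B>"
    if "B \<in> \<B>" for B i
    using that by (induction i) (auto simp: n_image intro: invariant[OF g(1)])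
  have np: "((\<lambda>A. n ` A) ^^ p) B = B" if "B \<in> \<B>" for B
    using pow_image_eq[OF that, of p] pow_image[OF gS B_subset[OF that], of p] K_image[OF g(2) that]
    by simp
  \<comment> \<open>For the \<open>p\<close>-part \<open>h\<close> of \<open>n\<close>, the power \<open>h\<^sup>p\<close> is an element of \<open>p\<close>-power order of the kernel, hence
    trivial.\<close>
  define N where "N = card G"
  have N0: "N \<noteq> 0" using finite_G g(1) by (auto simp: N_def)
  define b where "b = multiplicity p N"
  obtain l where l: "N = p ^ b * l" "\<not> p dvd l"
    using multiplicity_decompose'[of N p] N0 prime_p unfolding b_def
    by (metis not_prime_unit)
  define h where "h = n [^]\<^bsub>S\<^esub> l"
  have h: "h \<in> G" unfolding h_def using n G_pow by blast
  have nS: "n \<in> carrier S" using n G_carrier by blast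
  have hpb: "h [^]\<^bsub>S\<^esub> (p ^ b) = \<one>\<^bsub>S\<^esub>"
    unfolding h_def using S.pow_card_subgroup_eq_one[OF G n] nS l(1)
    by (simp add: S.nat_pow_pow N_def mult.commute)
  have h_image: "h ` B = ((\<lambda>A. n ` A) ^^ l) B" if "B \<in> \<B>" for B
    unfolding h_def using pow_image[OF nS B_subset[OF that]] .
  have "(h [^]\<^bsub>S\<^esub> p) ` B = B" if "B \<in> \<B>" for B
  proof -
    have "(h [^]\<^bsub>S\<^esub> p) ` B = (n [^]\<^bsub>S\<^esub> (p * l)) ` B"
      unfolding h_def using nS by (simp add: S.nat_pow_pow mult.commute)
    also have "\<dots> = ((\<lambda>A. n ` A) ^^ (p * l)) B" using pow_image[OF nS B_subset[OF that]] .
    also have "\<dots> = B" using funpow_fixed_mult np[OF that] by metis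
    finally show ?thesis .
  qed
  then have hpK: "h [^]\<^bsub>S\<^esub> p \<in> K" using G_pow[OF h] by (simp add: K_def)
  have "(h [^]\<^bsub>S\<^esub> p) [^]\<^bsub>S\<^esub> (p ^ b) = (h [^]\<^bsub>S\<^esub> (p ^ b)) [^]\<^bsub>S\<^esub> p"
    using G_carrier[OF h] by (simp add: S.nat_pow_pow mult.commute)
  then have "h [^]\<^bsub>S\<^esub> p = \<one>\<^bsub>S\<^esub>"
    using K_no_p_elements[OF hpK] hpb by simp
  moreover have "h ` B\<^sub>1 \<noteq> B\<^sub>1"
  proof
    assume "h ` B\<^sub>1 = B\<^sub>1"
    then have "((\<lambda>A. n ` A) ^^ l) B\<^sub>1 = B\<^sub>1" using h_image[OF g(3)] by simp
    moreover have "coprime l p" using l(2) prime_p by (metis coprime_commute prime_imp_coprime)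
    ultimately have "n ` B\<^sub>1 = B\<^sub>1" using fixed_of_coprime_funpow[OF np[OF g(3)]] by blast
    then show False using n_image[OF g(3)] g(4) by simp
  qed
  moreover have "h \<otimes>\<^bsub>S\<^esub> x \<otimes>\<^bsub>S\<^esub> inv\<^bsub>S\<^esub> h \<in> P" if "x \<in> P" for x
    unfolding h_def using S.conj_pow_mem[OF subgroup.subset[OF P(1)] nS nP that] .
  ultimately show ?thesis using P P'(2) a h g(3) by blast
qed

end


section \<open>The density condition\<close>

context minimal_imprimitive_group
begin

text \<open>The elements of \<open>G\<close> that act on the blocks as a power of the rotation \<open>g\<close> form a subgroup. It
  contains \<open>g\<close> and the kernel, so it is transitive and equals \<open>G\<close> by minimality.\<close>

lemma generated_by_kernel_and_rotation:
  assumes "g \<in> G" and "g [^]\<^bsub>S\<^esub> p \<in> K" and "B\<^sub>1 \<in> \<B>" and "g ` B\<^sub>1 \<noteq> B\<^sub>1" and "f \<in> G"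
  shows "\<exists>i. \<forall>B\<in>\<B>. f ` B = ((\<lambda>A. g ` A) ^^ i) B"
proof -
  let ?r = "\<lambda>A. g ` A"
  define H where "H = {h \<in> G. \<exists>i. \<forall>B\<in>\<B>. h ` B = (?r ^^ i) B}"
  have r_in: "(?r ^^ i) B \<in> \<B>" if "B \<in> \<B>" for i B
    using that by (induction i) (auto intro: invariant[OF assms(1)])
  have "subgroup H S"
  proof (rule S.subgroup_of_finite_mult_closed)
    show "H \<subseteq> carrier S" "finite H"
      using finite_G G_carrier by (auto simp: H_def)
    have "g \<in> H" using assms(1) by (auto simp: H_def intro!: exI[of _ 1])
    then show "H \<noteq> {}" by blast
    fix x y assume xy: "x \<in> H" "y \<in> H"
    then obtain i j where ij: "\<And>B. B \<in> \<B> \<Longrightarrow> x ` B = (?r ^^ i) B" "\<And>B. B \<in> \<B> \<Longrightarrow> y ` B = (?r ^^ j) B"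
      by (auto simp: H_def)
    have xyG: "x \<in> G" "y \<in> G" using xy by (auto simp: H_def)
    have "(x \<otimes>\<^bsub>S\<^esub> y) ` B = (?r ^^ (i + j)) B" if "B \<in> \<B>" for B
      using mult_image[OF G_carrier[OF xyG(1)] G_carrier[OF xyG(2)] B_subset[OF that]] ij that r_in
      by (simp add: funpow_add)
    then show "x \<otimes>\<^bsub>S\<^esub> y \<in> H" using G_mult[OF xyG] by (auto simp: H_def)
  qed
  moreover have "\<exists>h\<in>H. h x = y" if xy: "x \<in> \<Omega>" "y \<in> \<Omega>" for x y
  proof -
    obtain B B' where B: "B \<in> \<B>" "x \<in> B" and B': "B' \<in> \<B>" "y \<in> B'"
      using block_of xy by meson
    obtain i where i: "B' = (?r ^^ i) B"
      using rotation_blocks(1)[OF assms(1,2,3,4) B(1)] B'(1) by blast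
    define h where "h = g [^]\<^bsub>S\<^esub> i"
    have h: "h \<in> G" "h \<in> carrier S" using G_pow[OF assms(1)] G_carrier by (auto simp: h_def)
    have h_image: "h ` A = (?r ^^ i) A" if "A \<in> \<B>" for A
      unfolding h_def using pow_image[OF G_carrier[OF assms(1)] B_subset[OF that]] .
    have "h x \<in> B'" using h_image[OF B(1)] i B(2) by blast
    then obtain k where k: "k \<in> K" "k (h x) = y"
      using K_transitive_on_block[OF B'(1), of "h x"] B'(2) by blast
    have "(k \<otimes>\<^bsub>S\<^esub> h) ` A = (?r ^^ i) A" if "A \<in> \<B>" for A
      using mult_image[OF K_carrier[OF k(1)] h(2) B_subset[OF that]] h_image[OF that]
        K_image[OF k(1) r_in[OF that]] by simp
    moreover have "k \<otimes>\<^bsub>S\<^esub> h \<in> G" using k(1) K_subset h(1) G_mult by blast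
    ultimately have "k \<otimes>\<^bsub>S\<^esub> h \<in> H" by (auto simp: H_def)
    moreover have "(k \<otimes>\<^bsub>S\<^esub> h) x = y"
      using BijGroup_mult_apply[OF K_carrier[OF k(1)] h(2) xy(1)] k(2) by simp
    ultimately show ?thesis by blast
  qed
  ultimately have "H = G" by (intro minimal) (auto simp: H_def)
  then show ?thesis using assms(5) by (auto simp: H_def)
qed

lemma in_K_of_fixed_point:
  assumes "f \<in> G" and "\<omega> \<in> \<Omega>" and "f \<omega> = \<omega>"
  shows "f \<in> K"
proof -
  obtain g B\<^sub>1 where g: "g \<in> G" "g [^]\<^bsub>S\<^esub> p \<in> K" "B\<^sub>1 \<in> \<B>" "g ` B\<^sub>1 \<noteq> B\<^sub>1"
    using exists_rotation by blast
  obtain i where i: "\<And>B. B \<in> \<B> \<Longrightarrow> f ` B = ((\<lambda>A. g ` A) ^^ i) B"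
    using generated_by_kernel_and_rotation[OF g assms(1)] by blast
  obtain B where B: "B \<in> \<B>" "\<omega> \<in> B" using block_of[OF assms(2)] by blast
  have per: "((\<lambda>A. g ` A) ^^ p) A = A" if "A \<in> \<B>" for A
    using pow_image[OF G_carrier[OF g(1)] B_subset[OF that], of p] K_image[OF g(2) that] by simp
  have fB: "((\<lambda>A. g ` A) ^^ i) B = B"
    using image_eq_of_point[OF assms(1) B(1) B(1) B(2)] assms(3) B(2) i[OF B(1)] by simp
  have "p dvd i"
  proof (rule ccontr)
    assume "\<not> p dvd i"
    then have "coprime i p" using prime_p by (metis coprime_commute prime_imp_coprime)
    then show False
      using fixed_of_coprime_funpow[OF per[OF B(1)] fB] rotation_blocks(2)[OF g B(1)] by simp
  qed
  then obtain k where "i = p * k" by blast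
  then have "f ` A = A" if "A \<in> \<B>" for A
    using i[OF that] funpow_fixed_mult[of p "\<lambda>A. g ` A", OF per[OF that]] by simp
  then show ?thesis using assms(1) by (simp add: K_def)
qed

text \<open>The cosets of \<open>K\<close> given by the first \<open>p\<close> powers of a rotation are distinct.\<close>

lemma card_K_times_p_le: "p * card K \<le> card G"
proof -
  obtain g B\<^sub>1 where g: "g \<in> G" "g [^]\<^bsub>S\<^esub> p \<in> K" "B\<^sub>1 \<in> \<B>" "g ` B\<^sub>1 \<noteq> B\<^sub>1"
    using exists_rotation by blast
  have gS: "g \<in> carrier S" using G_carrier[OF g(1)] .
  let ?f = "\<lambda>(i::nat, k). g [^]\<^bsub>S\<^esub> i \<otimes>\<^bsub>S\<^esub> k"
  have "inj_on (\<lambda>i. ((\<lambda>A. g ` A) ^^ i) B\<^sub>1) {..<p}"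
    using rotation_blocks(1)[OF g g(3)] card_blocks by (intro eq_card_imp_inj_on) auto
  then have inj_i: "i = j" if "i < p" "j < p" "((\<lambda>A. g ` A) ^^ i) B\<^sub>1 = ((\<lambda>A. g ` A) ^^ j) B\<^sub>1" for i j
    using that by (auto dest: inj_onD)
  have image: "(g [^]\<^bsub>S\<^esub> (i::nat) \<otimes>\<^bsub>S\<^esub> k) ` B\<^sub>1 = ((\<lambda>A. g ` A) ^^ i) B\<^sub>1" if "k \<in> K" for i k
    using mult_image[OF _ K_carrier[OF that] B_subset[OF g(3)], of "g [^]\<^bsub>S\<^esub> i"] gS
      K_image[OF that g(3)] pow_image[OF gS B_subset[OF g(3)]] by simp
  have "inj_on ?f ({..<p} \<times> K)"
  proof (rule inj_onI)
    fix u v assume uv: "u \<in> {..<p} \<times> K" "v \<in> {..<p} \<times> K" "?f u = ?f v"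
    obtain i k j l where uv_eq: "u = (i, k)" "v = (j, l)" by (cases u, cases v)
    then have kl: "i < p" "j < p" "k \<in> K" "l \<in> K" "g [^]\<^bsub>S\<^esub> i \<otimes>\<^bsub>S\<^esub> k = g [^]\<^bsub>S\<^esub> j \<otimes>\<^bsub>S\<^esub> l"
      using uv by auto
    then have "i = j" using inj_i image by metis
    then show "u = v"
      using kl K_carrier gS S.Units_l_cancel S.Units_eq S.nat_pow_closed uv_eq by metis
  qed
  moreover have "?f ` ({..<p} \<times> K) \<subseteq> G"
    using G_pow[OF g(1)] G_mult K_subset by auto
  ultimately have "card ({..<p} \<times> K) \<le> card G"
    using finite_G card_inj_on_le by blast
  then show ?thesis by (simp add: card_cartesian_product)
qed

text \<open>Two elements of an intersecting set lie in the same coset of the kernel, so an intersecting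
  set of size \<open>|G| / p\<close> is a full coset of the kernel, and then the kernel is intersecting.\<close>

lemma kernel_no_derangement:
  assumes "F \<subseteq> G" and "intersecting \<Omega> F" and "p * card F = card G" and "x \<in> K"
  shows "\<exists>\<omega>\<in>\<Omega>. x \<omega> = \<omega>"
proof -
  have "card G \<noteq> 0" using finite_G subgroup.one_closed[OF G] by auto
  then obtain f where f: "f \<in> F" using assms(3) by (cases "F = {}") auto
  have fS: "f \<in> carrier S" using f assms(1) G_carrier by blast
  have cosets: "F \<subseteq> (\<lambda>k. f \<otimes>\<^bsub>S\<^esub> k) ` K"
  proof
    fix h assume h: "h \<in> F"
    have hS: "h \<in> carrier S" using h assms(1) G_carrier by blast
    obtain \<omega> where w: "\<omega> \<in> \<Omega>" "f \<omega> = h \<omega>"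
      using assms(2) f h by (auto simp: intersecting_def)
    have "(inv\<^bsub>S\<^esub> f \<otimes>\<^bsub>S\<^esub> h) \<omega> = \<omega>"
      using BijGroup_mult_apply[of "inv\<^bsub>S\<^esub> f" \<Omega> h \<omega>] fS hS w BijGroup_inv_apply(1)[OF fS w(1)] by simp
    moreover have "inv\<^bsub>S\<^esub> f \<otimes>\<^bsub>S\<^esub> h \<in> G" using f h assms(1) G_mult G_inv by blast
    ultimately have "inv\<^bsub>S\<^esub> f \<otimes>\<^bsub>S\<^esub> h \<in> K" using in_K_of_fixed_point w(1) by blast
    moreover have "h = f \<otimes>\<^bsub>S\<^esub> (inv\<^bsub>S\<^esub> f \<otimes>\<^bsub>S\<^esub> h)"
      using fS hS by (simp flip: S.m_assoc)
    ultimately show "h \<in> (\<lambda>k. f \<otimes>\<^bsub>S\<^esub> k) ` K" by blast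
  qed
  have "card ((\<lambda>k. f \<otimes>\<^bsub>S\<^esub> k) ` K) \<le> card K" using finite_K by (rule card_image_le)
  also have "card K \<le> card F"
    using card_K_times_p_le prime_gt_0_nat[OF prime_p] by (simp flip: assms(3))
  finally have "F = (\<lambda>k. f \<otimes>\<^bsub>S\<^esub> k) ` K"
    using cosets finite_K by (intro card_seteq) auto
  then have "f \<otimes>\<^bsub>S\<^esub> x \<in> F" using assms(4) by blast
  then obtain \<omega> where w: "\<omega> \<in> \<Omega>" "f \<omega> = (f \<otimes>\<^bsub>S\<^esub> x) \<omega>"
    using assms(2) f by (auto simp: intersecting_def)
  have "f \<omega> = f (x \<omega>)"
    using BijGroup_mult_apply[OF fS K_carrier[OF assms(4)] w(1)] w(2) by simp
  then have "\<omega> = x \<omega>"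
    using BijGroup_bij_betw[OF fS] w(1) BijGroup_apply_in[OF K_carrier[OF assms(4)] w(1)]
    by (auto simp: bij_betw_def inj_on_def)
  then show ?thesis using w(1) by metis
qed

text \<open>As \<open>|G| = p q |G\<^sub>\<omega>|\<close>, an intersecting set that attains the density \<open>q\<close> has \<open>|G| / p\<close> elements.\<close>

lemma intersecting_of_density:
  assumes "intersection_density \<Omega> G = real q"
  shows "\<exists>F. F \<subseteq> G \<and> intersecting \<Omega> F \<and> p * card F = card G"
proof -
  let ?st = "\<lambda>\<omega>. card (stabilizer (perm_group \<Omega> G) (\<lambda>g. g) \<omega>)"
  let ?D = "{real (card F) / real (?st \<omega>) | F \<omega>. \<omega> \<in> \<Omega> \<and> F \<subseteq> G \<and> intersecting \<Omega> F}"
  have "?D \<subseteq> (\<lambda>(F, \<omega>). real (card F) / real (?st \<omega>)) ` (Pow G \<times> \<Omega>)" by auto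
  then have "finite ?D" by (rule finite_subset) (use finite_G finite_Omega in auto)
  moreover have "?D \<noteq> {}"
  proof -
    have "\<Omega> \<noteq> {}" using card_Omega prime_p prime_q by auto
    moreover have "intersecting \<Omega> {}" by (simp add: intersecting_def)
    ultimately show ?thesis by blast
  qed
  ultimately have "Max ?D \<in> ?D" by (rule Max_in)
  then have "real q \<in> ?D" using assms by (simp only: intersection_density_def)
  then obtain F \<omega> where F: "\<omega> \<in> \<Omega>" "F \<subseteq> G" "intersecting \<Omega> F"
    "real q = real (card F) / real (?st \<omega>)" by blast
  have "?st \<omega> \<noteq> 0" using F(4) prime_q by (metis div_by_0 not_prime_0 of_nat_0 of_nat_eq_0_iff)
  then have "real (q * ?st \<omega>) = real (card F)" using F(4) by (simp add: field_simps)
  then have "p * card F = card G"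
    using card_G_eq[OF F(1)] by (metis of_nat_eq_iff mult.assoc)
  then show ?thesis using F by blast
qed

end


section \<open>The cyclic code of a subgroup of the kernel\<close>

lemma CHAR_of_prime_card:
  assumes "CARD('f::field) = q" and "prime q"
  shows "CHAR('f) = q"
proof -
  have "CHAR('f) dvd q" using CHAR_dvd_CARD[where 'a = 'f] assms(1) by simp
  then show ?thesis using assms(2) CHAR_not_1[where 'a = 'f] by (auto simp: prime_nat_iff)
qed

lemma surj_of_nat_of_prime_card:
  assumes "CARD('f::field) = q" and "prime q"
  shows "surj (of_nat :: nat \<Rightarrow> 'f)"
proof -
  have fin: "finite (UNIV :: 'f set)"
    using assms by (metis card.infinite not_prime_0)
  have "inj_on (of_nat :: nat \<Rightarrow> 'f) {..<q}"
    by (auto simp: inj_on_def of_nat_eq_iff_cong_CHAR CHAR_of_prime_card[OF assms] cong_def)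
  then have "card ((of_nat :: nat \<Rightarrow> 'f) ` {..<q}) = CARD('f)"
    using assms(1) by (simp add: card_image)
  then have "(of_nat :: nat \<Rightarrow> 'f) ` {..<q} = UNIV"
    using fin by (intro card_subset_eq) auto
  then show ?thesis by blast
qed

lemma (in vectorspace) dim_pos:
  assumes "finite (carrier V)" and "v \<in> carrier V" and "v \<noteq> \<zero>\<^bsub>V\<^esub>"
  shows "0 < dim"
proof (rule ccontr)
  assume "\<not> 0 < dim"
  moreover have "gen_set (carrier V)"
    using span_is_subset2[of "carrier V"] in_own_span[of "carrier V"] by auto
  then have "\<exists>n A. finite A \<and> card A = n \<and> A \<subseteq> carrier V \<and> gen_set A"
    using assms(1) by blast
  then have "\<exists>A. finite A \<and> card A = dim \<and> A \<subseteq> carrier V \<and> gen_set A"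
    unfolding dim_def by (rule LeastI_ex)
  ultimately have "gen_set {}" by auto
  then show False using assms(2,3) span_empty by auto
qed

text \<open>A \<open>q\<close>-subgroup \<open>P\<close> of the kernel normalized by a rotation \<open>g\<close> of order \<open>p\<close>, and an element
  \<open>s\<close> of \<open>P\<close> that moves the point \<open>\<omega>\<^sub>0\<close> of the block \<open>B\<^sub>0\<close>.\<close>

locale rotated_q_subgroup = minimal_imprimitive_group +
  fixes P :: "('a \<Rightarrow> 'a) set" and g s :: "'a \<Rightarrow> 'a" and a :: nat and B\<^sub>0 :: "'a set" and \<omega>\<^sub>0 :: 'a
  assumes P: "subgroup P (BijGroup \<Omega>)" and P_K: "P \<subseteq> K" and card_P: "card P = q ^ a"
    and g: "g \<in> G" and g_pow_p: "g [^]\<^bsub>BijGroup \<Omega>\<^esub> p = \<one>\<^bsub>BijGroup \<Omega>\<^esub>"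
    and g_moves: "\<exists>B\<in>\<B>. g ` B \<noteq> B"
    and g_normalizes: "\<And>x. x \<in> P \<Longrightarrow> g \<otimes>\<^bsub>BijGroup \<Omega>\<^esub> x \<otimes>\<^bsub>BijGroup \<Omega>\<^esub> inv\<^bsub>BijGroup \<Omega>\<^esub> g \<in> P"
    and s: "s \<in> P" and B\<^sub>0: "B\<^sub>0 \<in> \<B>" and \<omega>\<^sub>0: "\<omega>\<^sub>0 \<in> B\<^sub>0" and s_moves: "s \<omega>\<^sub>0 \<noteq> \<omega>\<^sub>0"
begin

lemma P_carrier: "x \<in> P \<Longrightarrow> x \<in> carrier S"
  using P subgroup.mem_carrier by metis

lemma g_carrier: "g \<in> carrier S"
  using g G_carrier by blast

lemma P_pow: "x \<in> P \<Longrightarrow> x [^]\<^bsub>S\<^esub> (n::nat) \<in> P"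
  using subgroup.one_closed[OF P] subgroup.m_closed[OF P] by (induction n) auto

lemma P_exponent: "x \<in> P \<Longrightarrow> x [^]\<^bsub>S\<^esub> (q ^ a) = \<one>\<^bsub>S\<^esub>"
  using S.pow_card_subgroup_eq_one[OF P] card_P by metis

lemma P_fixes_block:
  assumes "x \<in> P" and "B \<in> \<B>" and "\<omega> \<in> B" and "x \<omega> = \<omega>" and "y \<in> B"
  shows "x y = y"
  using fixes_block_of_fixed_point[OF _ P_exponent[OF assms(1)] assms(2-5)] assms(1) P_K by blast

lemma \<omega>\<^sub>0_in: "\<omega>\<^sub>0 \<in> \<Omega>"
  using \<omega>\<^sub>0 B\<^sub>0 B_subset by blast

lemma q_pow_pos: "0 < q ^ a"
  using prime_q prime_gt_0_nat by simp

lemma s_period: "(s ^^ (q ^ a)) \<omega>\<^sub>0 = \<omega>\<^sub>0"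
  using funpow_eq_of_pow_eq_one[OF P_carrier[OF s] P_exponent[OF s] \<omega>\<^sub>0_in] .

lemma B\<^sub>0_eq: "B\<^sub>0 = (\<lambda>j. (s ^^ j) \<omega>\<^sub>0) ` {..<q}"
proof (rule periodic_map_cyclic[where n = "q ^ a"])
  show "s ` B\<^sub>0 \<subseteq> B\<^sub>0" using K_image[OF _ B\<^sub>0] s P_K by blast
qed (use finite_B card_B B\<^sub>0 \<omega>\<^sub>0 s_period q_pow_pos s_moves coprime_below_prime_power[OF prime_q] in auto)

lemma s_power_unique:
  assumes "(s ^^ i) \<omega>\<^sub>0 = (s ^^ j) \<omega>\<^sub>0"
  shows "[i = j] (mod q)"
proof -
  have *: "[i = j] (mod q)" if "i < j" "(s ^^ i) \<omega>\<^sub>0 = (s ^^ j) \<omega>\<^sub>0" for i j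
  proof -
    have "\<not> coprime (j - i) (q ^ a)"
      using fixed_of_funpow_eq[OF s_period q_pow_pos that(1) _ that(2)] s_moves by blast
    then have "q dvd j - i"
      using prime_q by (metis coprime_commute coprime_power_right_iff prime_imp_coprime)
    then have "j mod q = i mod q" using that(1) by (simp add: mod_eq_dvd_iff_nat)
    then show ?thesis by (simp add: cong_def)
  qed
  show ?thesis
    using *[of i j] *[of j i] assms cong_sym by (cases i j rule: linorder_cases) auto
qed

text \<open>Each element \<open>x\<close> of \<open>P\<close> acts on the block \<open>B\<^sub>0\<close> as a power of \<open>s\<close>, whose exponent is determined
  modulo \<open>q\<close>. The representative \<open>ind x\<close> is the least exponent; outside \<open>P\<close> it has no meaning.\<close>

definition ind :: "('a \<Rightarrow> 'a) \<Rightarrow> nat" where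
  "ind x = (LEAST j. x \<omega>\<^sub>0 = (s ^^ j) \<omega>\<^sub>0)"

lemma ind:
  assumes "x \<in> P"
  shows "x \<omega>\<^sub>0 = (s ^^ ind x) \<omega>\<^sub>0" and "ind x < q"
proof -
  have "x \<omega>\<^sub>0 \<in> B\<^sub>0" using K_apply[OF _ B\<^sub>0 \<omega>\<^sub>0] assms P_K by blast
  then obtain j where j: "j < q" "x \<omega>\<^sub>0 = (s ^^ j) \<omega>\<^sub>0" using B\<^sub>0_eq by blast
  show "x \<omega>\<^sub>0 = (s ^^ ind x) \<omega>\<^sub>0"
    unfolding ind_def by (rule LeastI) (rule j(2))
  have "ind x \<le> j" unfolding ind_def by (rule Least_le) (rule j(2))
  then show "ind x < q" using j(1) by simp
qed

lemma ind_eq_0_iff: "x \<in> P \<Longrightarrow> ind x = 0 \<longleftrightarrow> x \<omega>\<^sub>0 = \<omega>\<^sub>0"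
  using ind(1)[of x] by (auto simp: ind_def)

text \<open>The exponent is read off at \<open>\<omega>\<^sub>0\<close>, but it is correct on all of \<open>B\<^sub>0\<close>, since an element of \<open>P\<close>
  that fixes \<open>\<omega>\<^sub>0\<close> fixes every point of \<open>B\<^sub>0\<close>.\<close>

lemma acts_as_power:
  assumes "x \<in> P" and "z \<in> B\<^sub>0"
  shows "x z = (s ^^ ind x) z"
proof -
  define t where "t = s [^]\<^bsub>S\<^esub> ind x"
  have t: "t \<in> P" "t \<in> carrier S" using P_pow[OF s] P_carrier by (auto simp: t_def)
  have t_apply: "t y = (s ^^ ind x) y" if "y \<in> B\<^sub>0" for y
    unfolding t_def using BijGroup_pow_apply[OF P_carrier[OF s]] B_subset[OF B\<^sub>0] that by blast
  define u where "u = inv\<^bsub>S\<^esub> t \<otimes>\<^bsub>S\<^esub> x"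
  have u: "u \<in> P"
    unfolding u_def using subgroup.m_closed[OF P] subgroup.m_inv_closed[OF P] t(1) assms(1) by metis
  have u_apply: "u y = (inv\<^bsub>S\<^esub> t) (x y)" if "y \<in> \<Omega>" for y
    unfolding u_def
    using BijGroup_mult_apply[OF S.inv_closed[OF t(2)] P_carrier[OF assms(1)] that] .
  have "u \<omega>\<^sub>0 = (inv\<^bsub>S\<^esub> t) (t \<omega>\<^sub>0)"
    using u_apply[OF \<omega>\<^sub>0_in] ind(1)[OF assms(1)] t_apply[OF \<omega>\<^sub>0] by simp
  then have "u \<omega>\<^sub>0 = \<omega>\<^sub>0" using BijGroup_inv_apply(1)[OF t(2) \<omega>\<^sub>0_in] by simp
  then have "u z = z" using P_fixes_block[OF u B\<^sub>0 \<omega>\<^sub>0 _ assms(2)] by blast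
  moreover have zO: "z \<in> \<Omega>" using assms(2) B_subset[OF B\<^sub>0] by blast
  moreover have "x z \<in> \<Omega>" using BijGroup_apply_in[OF P_carrier[OF assms(1)] zO] .
  ultimately have "x z = t z"
    using u_apply[OF zO] BijGroup_inv_apply(2)[OF t(2), of "x z"] by simp
  then show ?thesis using t_apply[OF assms(2)] by simp
qed

lemma ind_mult:
  assumes "x \<in> P" and "y \<in> P"
  shows "[ind (x \<otimes>\<^bsub>S\<^esub> y) = ind x + ind y] (mod q)"
proof (rule s_power_unique)
  have xy: "x \<otimes>\<^bsub>S\<^esub> y \<in> P" using subgroup.m_closed[OF P assms] .
  have y_in: "y \<omega>\<^sub>0 \<in> B\<^sub>0" using K_apply[OF _ B\<^sub>0 \<omega>\<^sub>0] assms P_K by blast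
  have "(s ^^ ind (x \<otimes>\<^bsub>S\<^esub> y)) \<omega>\<^sub>0 = (x \<otimes>\<^bsub>S\<^esub> y) \<omega>\<^sub>0" using ind(1)[OF xy] by simp
  also have "\<dots> = x (y \<omega>\<^sub>0)"
    using BijGroup_mult_apply[OF P_carrier[OF assms(1)] P_carrier[OF assms(2)] \<omega>\<^sub>0_in] .
  also have "\<dots> = (s ^^ ind x) (y \<omega>\<^sub>0)" using acts_as_power[OF assms(1) y_in] .
  also have "\<dots> = (s ^^ (ind x + ind y)) \<omega>\<^sub>0"
    using ind(1)[OF assms(2)] by (simp add: funpow_add)
  finally show "(s ^^ ind (x \<otimes>\<^bsub>S\<^esub> y)) \<omega>\<^sub>0 = (s ^^ (ind x + ind y)) \<omega>\<^sub>0" .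
qed

text \<open>Conjugation by the \<open>n\<close>-th power of the rotation.\<close>

definition conj :: "nat \<Rightarrow> ('a \<Rightarrow> 'a) \<Rightarrow> 'a \<Rightarrow> 'a" where
  "conj n x = g [^]\<^bsub>S\<^esub> n \<otimes>\<^bsub>S\<^esub> x \<otimes>\<^bsub>S\<^esub> inv\<^bsub>S\<^esub> (g [^]\<^bsub>S\<^esub> n)"

lemma conj_in_P: "x \<in> P \<Longrightarrow> conj n x \<in> P"
  unfolding conj_def by (rule S.conj_pow_mem[OF subgroup.subset[OF P] g_carrier g_normalizes])

lemma conj_mult:
  assumes "x \<in> P" and "y \<in> P"
  shows "conj n (x \<otimes>\<^bsub>S\<^esub> y) = conj n x \<otimes>\<^bsub>S\<^esub> conj n y"
  unfolding conj_def
  by (rule S.conj_mult) (use assms P_carrier g_carrier in auto)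

lemma conj_conj_g:
  assumes "x \<in> P"
  shows "conj n (g \<otimes>\<^bsub>S\<^esub> x \<otimes>\<^bsub>S\<^esub> inv\<^bsub>S\<^esub> g) = conj (Suc n) x"
  unfolding conj_def using P_carrier[OF assms] g_carrier
  by (simp add: S.m_assoc S.inv_mult_group)

lemma conj_period: "conj (n + p) x = conj n x"
  unfolding conj_def using g_pow_p g_carrier S.nat_pow_mult[of g n p]
  by (metis S.nat_pow_closed S.r_one)

lemma conj_apply:
  assumes "x \<in> P" and "\<omega> \<in> \<Omega>"
  shows "conj n x ((g [^]\<^bsub>S\<^esub> n) \<omega>) = (g [^]\<^bsub>S\<^esub> n) (x \<omega>)"
proof -
  have gn: "g [^]\<^bsub>S\<^esub> n \<in> carrier S" using g_carrier by simp
  then show ?thesis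
    unfolding conj_def using P_carrier[OF assms(1)] assms(2)
    by (simp add: BijGroup_mult_apply BijGroup_apply_in BijGroup_inv_apply(1))
qed

text \<open>The entry at \<open>i\<close> describes the action of \<open>x\<close> on the block \<open>g\<^sup>i(B\<^sub>0)\<close>, transported to \<open>B\<^sub>0\<close> by
  \<open>g\<^sup>-\<^sup>i = g\<^bsup>p-i\<^esup>\<close>; for \<open>x \<in> P\<close> it vanishes if and only if \<open>x\<close> fixes that block pointwise.\<close>

definition codeword :: "('a \<Rightarrow> 'a) \<Rightarrow> 'f::field vec" where
  "codeword x = vec p (\<lambda>i. of_nat (ind (conj (p - i) x)))"

lemma codeword_simps [simp]:
  "dim_vec (codeword x) = p"
  "codeword x \<in> carrier_vec p"
  "i < p \<Longrightarrow> codeword x $ i = of_nat (ind (conj (p - i) x))"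
  by (simp_all add: codeword_def)

context
  fixes f_type :: "'f::field itself"
  assumes card_f: "CARD('f) = q"
begin

lemma of_nat_ind_mult:
  assumes "x \<in> P" and "y \<in> P"
  shows "(of_nat (ind (x \<otimes>\<^bsub>S\<^esub> y)) :: 'f) = of_nat (ind x) + of_nat (ind y)"
  using ind_mult[OF assms] CHAR_of_prime_card[OF card_f prime_q]
  by (simp add: of_nat_eq_iff_cong_CHAR flip: of_nat_add)

lemma of_nat_ind_eq_0_iff:
  assumes "x \<in> P"
  shows "(of_nat (ind x) :: 'f) = 0 \<longleftrightarrow> x \<omega>\<^sub>0 = \<omega>\<^sub>0"
proof -
  have "(of_nat (ind x) :: 'f) = 0 \<longleftrightarrow> q dvd ind x"
    using of_nat_eq_0_iff_char_dvd[where 'a = 'f] CHAR_of_prime_card[OF card_f prime_q] by simp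
  also have "\<dots> \<longleftrightarrow> ind x = 0" using ind(2)[OF assms] by (auto dest: dvd_imp_le)
  finally show ?thesis using ind_eq_0_iff[OF assms] by simp
qed

lemma codeword_mult:
  assumes "x \<in> P" and "y \<in> P"
  shows "codeword (x \<otimes>\<^bsub>S\<^esub> y) = (codeword x + codeword y :: 'f vec)"
  by (rule eq_vecI) (use assms in \<open>simp_all add: conj_mult of_nat_ind_mult conj_in_P\<close>)

lemma codeword_one: "codeword \<one>\<^bsub>S\<^esub> = (0\<^sub>v p :: 'f vec)"
proof (rule eq_vecI)
  fix i assume i: "i < dim_vec (0\<^sub>v p :: 'f vec)"
  have "conj (p - i) \<one>\<^bsub>S\<^esub> = \<one>\<^bsub>S\<^esub>" unfolding conj_def using g_carrier by simp
  then show "codeword \<one>\<^bsub>S\<^esub> $ i = (0\<^sub>v p :: 'f vec) $ i"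
    using i of_nat_ind_eq_0_iff[OF subgroup.one_closed[OF P]] BijGroup_one_apply[OF \<omega>\<^sub>0_in] by simp
qed simp

lemma codeword_pow:
  assumes "x \<in> P"
  shows "codeword (x [^]\<^bsub>S\<^esub> (n::nat)) = (of_nat n \<cdot>\<^sub>v codeword x :: 'f vec)"
proof (induction n)
  case 0
  then show ?case using codeword_one by (auto intro!: eq_vecI)
next
  case (Suc n)
  have "codeword (x [^]\<^bsub>S\<^esub> Suc n) = (codeword (x [^]\<^bsub>S\<^esub> n) + codeword x :: 'f vec)"
    using codeword_mult[OF P_pow[OF assms] assms] by simp
  then show ?case
    unfolding Suc.IH by (auto intro!: eq_vecI simp: algebra_simps)
qed

text \<open>Closure under scalars holds because every scalar is a multiple of \<open>1\<close>.\<close>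

lemma subspace_code: "VectorSpace.subspace class_ring (codeword ` P :: 'f vec set) (module_vec TYPE('f) p)"
proof (rule VectorSpace.subspace.intro)
  show "vectorspace class_ring (module_vec TYPE('f) p)" by (rule vec_vs)
  show "submodule class_ring (codeword ` P :: 'f vec set) (module_vec TYPE('f) p)"
  proof (rule submodule.intro)
    show "Module.module class_ring (module_vec TYPE('f) p)" by (rule vec_module)
    show "(codeword ` P :: 'f vec set) \<subseteq> carrier (module_vec TYPE('f) p)"
      by (auto simp: module_vec_simps)
    show "\<zero>\<^bsub>module_vec TYPE('f) p\<^esub> \<in> codeword ` P"
      using codeword_one subgroup.one_closed[OF P] by (metis imageI module_vec_simps(2))
    fix v w :: "'f vec" and c :: 'f
    assume "v \<in> codeword ` P"
    then obtain x where x: "x \<in> P" "v = codeword x" by blast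
    obtain n where "c = of_nat n" using surj_of_nat_of_prime_card[OF card_f prime_q] by (metis surjD)
    then have "c \<cdot>\<^sub>v v = codeword (x [^]\<^bsub>S\<^esub> n)" using codeword_pow[OF x(1)] x(2) by simp
    then show "c \<odot>\<^bsub>module_vec TYPE('f) p\<^esub> v \<in> codeword ` P"
      using P_pow[OF x(1)] by (simp add: module_vec_simps)
    assume "w \<in> codeword ` P"
    then obtain y where y: "y \<in> P" "w = codeword y" by blast
    then have "v + w = codeword (x \<otimes>\<^bsub>S\<^esub> y)" using codeword_mult x by simp
    then show "v \<oplus>\<^bsub>module_vec TYPE('f) p\<^esub> w \<in> codeword ` P"
      using subgroup.m_closed[OF P x(1) y(1)] by (simp add: module_vec_simps)
  qed
qed

lemma cyclic_shift_codeword: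
  assumes "x \<in> P"
  shows "cyclic_shift (codeword x) = (codeword (g \<otimes>\<^bsub>S\<^esub> x \<otimes>\<^bsub>S\<^esub> inv\<^bsub>S\<^esub> g) :: 'f vec)"
proof (rule eq_vecI)
  fix i assume "i < dim_vec (codeword (g \<otimes>\<^bsub>S\<^esub> x \<otimes>\<^bsub>S\<^esub> inv\<^bsub>S\<^esub> g) :: 'f vec)"
  then have i: "i < p" by simp
  define j where "j = (i + p - 1) mod p"
  have p1: "1 < p" using prime_gt_1_nat[OF prime_p] .
  have j: "j < p" using p1 by (simp add: j_def)
  have "conj (p - j) x = conj (Suc (p - i)) x"
  proof (cases "i = 0")
    case True
    then have "p - j = 1" using p1 by (simp add: j_def)
    then show ?thesis using conj_period[of 1 x] True by simp
  next
    case False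
    then have "i + p - 1 = i - 1 + p" by simp
    moreover have "(i - 1 + p) mod p = i - 1" using i by simp
    ultimately have "j = i - 1" unfolding j_def by (simp only:)
    then have "p - j = Suc (p - i)" using False i by simp
    then show ?thesis by simp
  qed
  then show "cyclic_shift (codeword x) $ i = (codeword (g \<otimes>\<^bsub>S\<^esub> x \<otimes>\<^bsub>S\<^esub> inv\<^bsub>S\<^esub> g) :: 'f vec) $ i"
    using i j conj_conj_g[OF assms, of "p - i"] by (simp add: cyclic_shift_def j_def)
qed (simp add: cyclic_shift_def)

lemma codeword_zero_entry:
  assumes "x \<in> P" and "\<omega> \<in> \<Omega>" and "x \<omega> = \<omega>"
  shows "\<exists>i<p. codeword x $ i = (0 :: 'f)"
proof -
  obtain B where B: "B \<in> \<B>" "\<omega> \<in> B" using block_of[OF assms(2)] by blast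
  obtain B\<^sub>1 where B\<^sub>1: "B\<^sub>1 \<in> \<B>" "g ` B\<^sub>1 \<noteq> B\<^sub>1" using g_moves by blast
  have gpK: "g [^]\<^bsub>S\<^esub> p \<in> K" using g_pow_p subgroup.one_closed[OF K_subgroup] by simp
  obtain n where n: "n < p" "B\<^sub>0 = ((\<lambda>A. g ` A) ^^ n) B"
    using rotation_blocks(1)[OF g gpK B\<^sub>1 B(1)] B\<^sub>0 by blast
  then have "(g [^]\<^bsub>S\<^esub> n) ` B = B\<^sub>0" using pow_image[OF g_carrier B_subset[OF B(1)]] by simp
  then have "(g [^]\<^bsub>S\<^esub> n) \<omega> \<in> B\<^sub>0" using B(2) by blast
  moreover have "conj n x ((g [^]\<^bsub>S\<^esub> n) \<omega>) = (g [^]\<^bsub>S\<^esub> n) \<omega>"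
    using conj_apply[OF assms(1,2)] assms(3) by simp
  ultimately have "conj n x \<omega>\<^sub>0 = \<omega>\<^sub>0"
    using P_fixes_block[OF conj_in_P[OF assms(1)] B\<^sub>0 _ _ \<omega>\<^sub>0] by blast
  then have zero: "(of_nat (ind (conj n x)) :: 'f) = 0"
    using of_nat_ind_eq_0_iff[OF conj_in_P[OF assms(1)]] by blast
  show ?thesis
  proof (cases "n = 0")
    case True
    then have "codeword x $ 0 = (0 :: 'f)"
      using zero conj_period[of 0 x] n(1) by simp
    then show ?thesis using n(1) True by auto
  next
    case False
    then have "codeword x $ (p - n) = (0 :: 'f)" using zero n(1) by simp
    moreover have "p - n < p" using False n(1) by simp
    ultimately show ?thesis by blast
  qed
qed

lemma exists_cyclic_code:
  assumes "\<And>x. x \<in> P \<Longrightarrow> \<exists>\<omega>\<in>\<Omega>. x \<omega> = \<omega>"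
  shows "\<exists>k (C :: 'f vec set). k \<ge> 1 \<and> cyclic_code p k C \<and> (\<forall>c\<in>C. hamming_weight c \<le> p - 1)"
proof -
  let ?C = "codeword ` P :: 'f vec set"
  let ?V = "(module_vec TYPE('f) p)\<lparr>carrier := ?C\<rparr>"
  define k where "k = vectorspace.dim class_ring ?V"
  interpret V: vectorspace class_ring ?V
    using vectorspace.subspace_is_vs[OF vec_vs subspace_code] .
  have p0: "0 < p" using prime_gt_0_nat[OF prime_p] .
  have "conj p s = s"
    using conj_period[of 0 s] P_carrier[OF s] by (simp add: conj_def)
  then have "(codeword s :: 'f vec) $ 0 \<noteq> 0"
    using of_nat_ind_eq_0_iff[OF s] s_moves p0 by simp
  then have nonzero: "(codeword s :: 'f vec) \<noteq> 0\<^sub>v p" using p0 by (metis index_zero_vec(1))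
  have finP: "finite P" using P_K finite_K finite_subset by blast
  have "0 < V.dim"
    by (rule V.dim_pos[of "codeword s"]) (use finP s nonzero in \<open>auto simp: module_vec_simps\<close>)
  moreover have "cyclic_code p k ?C"
    unfolding cyclic_code_def linear_code_def k_def
    using subspace_code cyclic_shift_codeword g_normalizes by auto
  moreover have "hamming_weight c \<le> p - 1" if "c \<in> ?C" for c
  proof -
    obtain x where x: "x \<in> P" "c = codeword x" using \<open>c \<in> ?C\<close> by blast
    obtain i where i: "i < p" "c $ i = 0"
      using assms[OF x(1)] codeword_zero_entry[OF x(1)] x(2) by metis
    have "{j. j < dim_vec c \<and> c $ j \<noteq> 0} \<subseteq> {..<p} - {i}" using i x(2) by auto
    then have "hamming_weight c \<le> card ({..<p} - {i})"
      unfolding hamming_weight_def by (intro card_mono) auto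
    then show ?thesis using i(1) by simp
  qed
  ultimately show ?thesis unfolding k_def by (metis One_nat_def Suc_leI)
qed

end

end


section \<open>From the density to the code\<close>

lemma block_kernel_eq:
  "block_kernel \<Omega> G \<B> = {g \<in> G. \<forall>B\<in>\<B>. g ` B = B}"
  unfolding block_kernel_def kernel_def perm_group_def block_action_def BijGroup_def
  by (auto simp: fun_eq_iff restrict_def)

lemma (in minimal_imprimitive_group) exists_cyclic_code_of_density:
  assumes "intersection_density \<Omega> G = real q" and "CARD('f::field) = q"
  shows "\<exists>k (C :: 'f vec set). k \<ge> 1 \<and> cyclic_code p k C \<and> (\<forall>c\<in>C. hamming_weight c \<le> p - 1)"
proof -
  obtain P g a where P: "subgroup P S" "P \<subseteq> K" "card P = q ^ a" "0 < a"
    and g: "g \<in> G" "g [^]\<^bsub>S\<^esub> p = \<one>\<^bsub>S\<^esub>" "\<exists>B\<in>\<B>. g ` B \<noteq> B"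
      "\<And>x. x \<in> P \<Longrightarrow> g \<otimes>\<^bsub>S\<^esub> x \<otimes>\<^bsub>S\<^esub> inv\<^bsub>S\<^esub> g \<in> P"
    using exists_sylow_normalized_by_rotation by blast
  have "card P > 1" unfolding P(3) using prime_gt_1_nat[OF prime_q] P(4) by (rule one_less_power)
  then have "P \<noteq> {\<one>\<^bsub>S\<^esub>}" by auto
  then obtain s where s: "s \<in> P" "s \<noteq> \<one>\<^bsub>S\<^esub>" using subgroup.one_closed[OF P(1)] by blast
  then obtain \<omega>\<^sub>0 where w: "\<omega>\<^sub>0 \<in> \<Omega>" "s \<omega>\<^sub>0 \<noteq> \<omega>\<^sub>0"
    using BijGroup_eqI[of s \<Omega> "\<one>\<^bsub>S\<^esub>"] subgroup.mem_carrier[OF P(1)] BijGroup_one_apply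
    by (metis S.one_closed)
  obtain B\<^sub>0 where B: "B\<^sub>0 \<in> \<B>" "\<omega>\<^sub>0 \<in> B\<^sub>0" using block_of[OF w(1)] by blast
  interpret R: rotated_q_subgroup p q \<Omega> G \<B> P g s a B\<^sub>0 \<omega>\<^sub>0
    by (intro rotated_q_subgroup.intro minimal_imprimitive_group_axioms
          rotated_q_subgroup_axioms.intro) (fact P g s(1) w(2) B)+
  obtain F where F: "F \<subseteq> G" "intersecting \<Omega> F" "p * card F = card G"
    using intersecting_of_density[OF assms(1)] by blast
  have "\<exists>\<omega>\<in>\<Omega>. x \<omega> = \<omega>" if "x \<in> P" for x
    using kernel_no_derangement[OF F] that P(2) by blast
  then show ?thesis by (rule R.exists_cyclic_code[OF assms(2)])
qed

theorem theorem1p5: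
  fixes p q :: nat
    and \<Omega> :: "'a set"
    and G :: "('a \<Rightarrow> 'a) set"
    and \<B> :: "'a set set"
  assumes "prime p" and "prime q" and "odd p" and "odd q" and "q < p"
    and "finite \<Omega>" and "card \<Omega> = p * q"
    and "subgroup G (BijGroup \<Omega>)"
    and "transitive_on \<Omega> G"
    and "nontrivial_block_system \<Omega> G \<B>"
    and "\<And>\<B>'. nontrivial_block_system \<Omega> G \<B>' \<Longrightarrow> \<B>' = \<B>"
    and "\<And>S. S \<in> \<B> \<Longrightarrow> card S = q"
    and "block_kernel \<Omega> G \<B> \<noteq> {\<one>\<^bsub>BijGroup \<Omega>\<^esub>}"
    and "minimally_transitive \<Omega> G"
    and "intersection_density \<Omega> G = real q"
    and "CARD('f) = q"
  shows "\<exists>k (C :: 'f::field vec set). k \<ge> 1 \<and> cyclic_code p k C \<and>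
           (\<forall>c\<in>C. hamming_weight c \<le> p - 1)"
proof -
  have part: "partition_on \<Omega> \<B>"
    using assms(10) by (simp add: nontrivial_block_system_def)
  obtain T where T: "T \<subseteq> \<Omega>" "\<B> = (\<lambda>g. g ` T) ` G"
    using assms(10) by (auto simp: nontrivial_block_system_def is_block_def)
  have carrier: "h \<in> carrier (BijGroup \<Omega>)" if "h \<in> G" for h
    using that assms(8) subgroup.mem_carrier by metis
  have inv: "g ` B \<in> \<B>" if gB: "g \<in> G" "B \<in> \<B>" for g B
  proof -
    obtain h where h: "h \<in> G" "B = h ` T" using T(2) gB(2) by blast
    have "g ` h ` T = (g \<otimes>\<^bsub>BijGroup \<Omega>\<^esub> h) ` T"
      unfolding image_image
      using BijGroup_mult_apply[OF carrier[OF gB(1)] carrier[OF h(1)]] T(1)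
      by (intro image_cong) auto
    then show ?thesis
      using subgroup.m_closed[OF assms(8) gB(1) h(1)] T(2) h(2) by auto
  qed
  have "q * card \<B> = card (\<Union>\<B>)"
  proof (rule card_partition)
    show "finite \<B>" "finite (\<Union>\<B>)"
      using part assms(6) by (auto simp: partition_on_def intro: finite_UnionD)
  qed (use part assms(12) in \<open>auto simp: partition_on_def disjoint_def\<close>)
  then have card_blocks: "card \<B> = p"
    using part assms(2,7) prime_gt_0_nat[OF assms(2)] by (simp add: partition_on_def)
  have "\<one>\<^bsub>BijGroup \<Omega>\<^esub> \<in> block_kernel \<Omega> G \<B>"
  proof -
    have "\<one>\<^bsub>BijGroup \<Omega>\<^esub> ` B = (\<lambda>x. x) ` B" if "B \<in> \<B>" for B
      using part that by (intro image_cong refl BijGroup_one_apply) (auto simp: partition_on_def)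
    then show ?thesis
      using subgroup.one_closed[OF assms(8)] by (simp add: block_kernel_eq)
  qed
  then obtain k where k: "k \<in> block_kernel \<Omega> G \<B>" "k \<noteq> \<one>\<^bsub>BijGroup \<Omega>\<^esub>"
    using assms(13) by blast
  then have kG: "k \<in> G" by (simp add: block_kernel_eq)
  have "\<exists>x\<in>\<Omega>. k x \<noteq> x"
    using k(2) BijGroup_eqI[OF carrier[OF kG] carrier[OF subgroup.one_closed[OF assms(8)]]]
      BijGroup_one_apply by metis
  then have nontriv: "\<exists>g\<in>G. (\<forall>B\<in>\<B>. g ` B = B) \<and> (\<exists>x\<in>\<Omega>. g x \<noteq> x)"
    using k(1) by (auto simp: block_kernel_eq)
  have min: "H = G" if H: "subgroup H (BijGroup \<Omega>)" "H \<subseteq> G"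
    "\<And>x y. x \<in> \<Omega> \<Longrightarrow> y \<in> \<Omega> \<Longrightarrow> \<exists>g\<in>H. g x = y" for H
  proof (rule ccontr)
    assume "H \<noteq> G"
    then have "\<not> transitive_on \<Omega> H"
      using assms(14) H(1,2) by (auto simp: minimally_transitive_def)
    then show False using transitive_on_iff[OF H(1)] H(3) by blast
  qed
  have trans: "\<exists>g\<in>G. g x = y" if "x \<in> \<Omega>" "y \<in> \<Omega>" for x y
    using transitive_on_iff[OF assms(8)] assms(9) that by blast
  interpret minimal_imprimitive_group p q \<Omega> G \<B>
    by (intro minimal_imprimitive_group.intro)
      (fact assms(1,2,5,6,8) trans part inv assms(12) card_blocks nontriv min)+
  show ?thesis using exists_cyclic_code_of_density[OF assms(15,16)] .
qed

end
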